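(* Let $n\ge 2$, let $(p_{j,r})\in[0,1]^{[n]\times[n]}$ with $\lambda>0$, and let $S_n$ be the random diagonal sum of the associated Bernoulli matrix. Then $$d_{\mathrm{TV}}(P^{S_n},\mathrm{Po}(\lambda))\le \frac{1-e^{-\lambda}}{\lambda}\bigl(\lambda-\mathrm{Var}\,S_n+\gamma'\bigr),$$ and moreover $$\frac{1-e^{-\lambda}}{\lambda}\bigl(\lambda-\mathrm{Var}\,S_n+\gamma'\bigr)=\frac{1-e^{-\lambda}}{\lambda}\Bigl(\sum_{j=1}^n\overline{p}_{j,\cdot}^2+\gamma''\Bigr)=\frac{1-e^{-\lambda}}{\lambda}\Bigl(\frac1n\sum_{j=1}^n\sum_{r=1}^n p_{j,r}^2-\gamma'''\Bigr).$$
   Context: Setting: $n\ge2$ is an integer, $[n]=\{1,\dots,n\}$, and $[n]^2_{\ne}$ is the set of ordered pairs of distinct elements of $[n]$. $X_{j,r}$ ($j,r\in[n]$) are Bernoulli random variables with success probabilities $p_{j,r}\in[0,1]$, $\pi$ is a uniformly distributed random permutation of $[n]$, and all $X_{j,r}$ and $\pi$ are independent. $S_n=\sum_{j=1}^nX_{j,\pi(j)}$, and $P^{S_n}$ is its distribution. Put $\overline{p}_{j,\cdot}=\frac1n\sum_{r=1}^np_{j,r}$ and $\lambda=E S_n=\frac1n\sum_{j=1}^n\sum_{r=1}^np_{j,r}$, assumed $>0$. $\mathrm{Po}(t)$ is the Poisson distribution with mean $t$. With $\mathbb Z_+=\{0,1,2,\dots\}$, $d_{\mathrm{TV}}(Q_1,Q_2)=\sup_{A\subseteq\mathbb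 Z_+}|Q_1(A)-Q_2(A)|$. With $x_+=\max\{0,x\}$, $$\gamma'=\frac{2}{n^2(n-1)}\sum_{(j,k)\in[n]^2_{\ne}}\sum_{(r,s)\in[n]^2_{\ne}}(p_{j,r}-p_{j,s})_+(p_{k,s}-p_{k,r})_+,$$ $$\gamma''=\frac{1}{2n^2(n-1)}\sum_{(j,k)\in[n]^2_{\ne}}\sum_{(r,s)\in[n]^2_{\ne}}|p_{j,r}-p_{j,s}|\,|p_{k,r}-p_{k,s}|,$$ $$\gamma'''=\frac{1}{4n^2(n-1)}\sum_{(j,k)\in[n]^2_{\ne}}\sum_{(r,s)\in[n]^2_{\ne}}\bigl(|p_{j,r}-p_{j,s}|-|p_{k,r}-p_{k,s}|\bigr)^2.$$ *)

theory Defs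
  imports "HOL-Probability.Probability" "HOL-Combinatorics.Permutations"
begin

definition perms :: "nat \<Rightarrow> (nat \<Rightarrow> nat) set" where
  "perms n = {\<sigma>. \<sigma> permutes {1..n}}"

definition distinct_pairs :: "nat \<Rightarrow> (nat \<times> nat) set" where
  "distinct_pairs n = {(j, k). j \<in> {1..n} \<and> k \<in> {1..n} \<and> j \<noteq> k}"

text \<open>
  Joint independence of all the entries \<open>X j r\<close> and of \<open>\<pi>\<close>. The library constant \<open>indep_vars\<close>
  requires all members of a family to have values in one type, whereas the entries are numbers and
  \<open>\<pi>\<close> is a permutation; so independence is stated for the \<open>\<sigma>\<close>-algebras generated by them.
  The index \<open>None\<close> belongs to \<open>\<pi>\<close>, the index \<open>Some (j, r)\<close> to \<open>X j r\<close>.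
\<close>

definition (in prob_space) indep_matrix_perm ::
    "nat \<Rightarrow> (nat \<Rightarrow> nat \<Rightarrow> 'a \<Rightarrow> nat) \<Rightarrow> ('a \<Rightarrow> nat \<Rightarrow> nat) \<Rightarrow> bool" where
  "indep_matrix_perm n X \<pi> \<longleftrightarrow>
     indep_sets
       (\<lambda>i. case i of
          None \<Rightarrow> {\<pi> -` A \<inter> space M | A. A \<in> sets (count_space (perms n))}
        | Some (j, r) \<Rightarrow> {X j r -` A \<inter> space M | A. A \<in> sets (count_space UNIV)})
       (insert None (Some ` ({1..n} \<times> {1..n})))"

definition d_TV :: "nat measure \<Rightarrow> nat measure \<Rightarrow> real" where
  "d_TV Q1 Q2 = (SUP A. \<bar>measure Q1 A - measure Q2 A\<bar>)"

definition row_mean :: "nat \<Rightarrow> (nat \<Rightarrow> nat \<Rightarrow> real) \<Rightarrow> nat \<Rightarrow> real" where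
  "row_mean n p j = (1 / real n) * (\<Sum>r=1..n. p j r)"

definition gamma1 :: "nat \<Rightarrow> (nat \<Rightarrow> nat \<Rightarrow> real) \<Rightarrow> real" where
  "gamma1 n p = 2 / ((real n)\<^sup>2 * (real n - 1)) *
     (\<Sum>(j, k)\<in>distinct_pairs n. \<Sum>(r, s)\<in>distinct_pairs n.
        max 0 (p j r - p j s) * max 0 (p k s - p k r))"

definition gamma2 :: "nat \<Rightarrow> (nat \<Rightarrow> nat \<Rightarrow> real) \<Rightarrow> real" where
  "gamma2 n p = 1 / (2 * (real n)\<^sup>2 * (real n - 1)) *
     (\<Sum>(j, k)\<in>distinct_pairs n. \<Sum>(r, s)\<in>distinct_pairs n.
        \<bar>p j r - p j s\<bar> * \<bar>p k r - p k s\<bar>)"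

definition gamma3 :: "nat \<Rightarrow> (nat \<Rightarrow> nat \<Rightarrow> real) \<Rightarrow> real" where
  "gamma3 n p = 1 / (4 * (real n)\<^sup>2 * (real n - 1)) *
     (\<Sum>(j, k)\<in>distinct_pairs n. \<Sum>(r, s)\<in>distinct_pairs n.
        (\<bar>p j r - p j s\<bar> - \<bar>p k r - p k s\<bar>)\<^sup>2)"

end

theory Submission
  imports Defs
begin

text \<open>
  The proof is Stein's method for the Poisson distribution; \<open>\<lambda>\<close> is the mean of \<open>S\<close>.
  For a set \<open>A\<close> of natural numbers let \<open>g\<close>
  solve \<open>\<lambda> g(k + 1) - k g(k) = 1\<^sub>A(k) - Po(\<lambda>)(A)\<close>; then the difference of the two probabilities of
  \<open>A\<close> is \<open>E (\<lambda> g(S + 1) - S g(S))\<close>, and the increments of \<open>g\<close> at positive arguments are bounded by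
  \<open>(1 - e\<^sup>-\<^sup>\<lambda>) / \<lambda>\<close> (\<open>abs_stein_sol_increment_le\<close>).

  The expectation is computed exactly, for every \<open>g\<close>, in \<open>stein_identity\<close>. Given the permutation, \<open>S\<close>
  is a sum of independent Bernoulli variables. Size biasing removes one row \<open>j\<close>, and a transposition
  of \<open>j\<close> with a second row \<open>k\<close> makes the two expectations comparable: they differ only in rows \<open>j\<close>
  and \<open>k\<close>. Let the two columns assigned to these rows be \<open>r\<close> and \<open>s\<close>, and let \<open>a\<close>, \<open>b\<close> be the
  entries of row \<open>j\<close> and \<open>c\<close>, \<open>d\<close> those of row \<open>k\<close> in these columns. After symmetrising over the
  exchanges of the rows and of the columns, the contribution is
  \<open>(2(ab + cd) + 2(a - b)(c - d) - t) x + t y\<close>, where \<open>t = ab(c + d) + cd(a + b)\<close> and \<open>x\<close>, \<open>y\<close> are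
  expected increments of \<open>g\<close>. The triangle inequality suffices, because \<open>0 \<le> t \<le> 2(ab + cd)\<close>:
  if the increments are bounded by \<open>C\<close>, the contribution is at most
  \<open>C (2(ab + cd) + 2\<bar>a - b\<bar>\<bar>c - d\<bar>)\<close>. Averaging over all permutations gives the bound with the squared
  row means and \<open>gamma2\<close> (\<open>abs_perm_avg_stein_le\<close>).

  The same identity for \<open>g k = k\<close> evaluates \<open>\<lambda> - Var S\<close>: the products \<open>(a - b)(c - d)\<close> then occur
  without absolute values, and adding \<open>gamma1\<close> restores these (\<open>gamma1_eq\<close>). The formula with
  \<open>gamma3\<close> follows by expanding the square (\<open>gamma3_eq\<close>).
\<close>

section \<open>Sums of independent Bernoulli variables\<close>

text \<open>
  The expectation of \<open>f\<close> at a sum of independent Bernoulli variables with success probabilities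
  \<open>q i\<close>, \<open>i \<in> J\<close>: the set \<open>A\<close> runs over the possible sets of successes.
\<close>

definition poisbin :: "'a set \<Rightarrow> ('a \<Rightarrow> real) \<Rightarrow> (nat \<Rightarrow> real) \<Rightarrow> real" where
  "poisbin J q f = (\<Sum>A\<in>Pow J. (\<Prod>i\<in>A. q i) * (\<Prod>i\<in>J - A. 1 - q i) * f (card A))"

lemma poisbin_cong:
  assumes "\<And>i. i \<in> J \<Longrightarrow> q i = q' i" and "\<And>k. f k = f' k"
  shows "poisbin J q f = poisbin J q' f'"
  unfolding poisbin_def using assms
  by (intro sum.cong refl arg_cong2[where f = "(*)"] prod.cong) auto

lemma poisbin_add: "poisbin J q (\<lambda>k. f k + g k) = poisbin J q f + poisbin J q g"
  by (simp add: poisbin_def algebra_simps sum.distrib)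

lemma poisbin_cmult: "poisbin J q (\<lambda>k. c * f k) = c * poisbin J q f"
  by (simp add: poisbin_def sum_distrib_left mult_ac)

lemma poisbin_diff: "poisbin J q (\<lambda>k. f k - g k) = poisbin J q f - poisbin J q g"
  by (simp add: poisbin_def algebra_simps sum_subtractf)

lemma poisbin_empty [simp]: "poisbin {} q f = f 0"
  by (simp add: poisbin_def)

text \<open>Conditioning on the value of one of the Bernoulli variables.\<close>

lemma poisbin_insert:
  assumes "finite J" and "i \<notin> J"
  shows "poisbin (insert i J) q f = q i * poisbin J q (\<lambda>k. f (Suc k)) + (1 - q i) * poisbin J q f"
proof -
  let ?w = "\<lambda>J A. (\<Prod>i\<in>A. q i) * (\<Prod>i\<in>J - A. 1 - q i) * f (card A)"
  have inj: "inj_on (insert i) (Pow J)"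
    using assms(2) by (auto simp: inj_on_def)
  have "poisbin (insert i J) q f =
      (\<Sum>A\<in>Pow J. ?w (insert i J) A) + (\<Sum>A\<in>insert i ` Pow J. ?w (insert i J) A)"
    unfolding poisbin_def Pow_insert using assms by (intro sum.union_disjoint) auto
  also have "(\<Sum>A\<in>Pow J. ?w (insert i J) A) = (1 - q i) * poisbin J q f"
    unfolding poisbin_def sum_distrib_left
  proof (intro sum.cong refl)
    fix A assume "A \<in> Pow J"
    then have "insert i J - A = insert i (J - A)" and "finite (J - A)" and "i \<notin> J - A"
      using assms by auto
    then show "?w (insert i J) A = (1 - q i) * ?w J A"
      by simp
  qed
  also have "(\<Sum>A\<in>insert i ` Pow J. ?w (insert i J) A) = q i * poisbin J q (\<lambda>k. f (Suc k))"
    unfolding poisbin_def sum_distrib_left sum.reindex[OF inj] o_def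
  proof (intro sum.cong refl)
    fix A assume "A \<in> Pow J"
    then have "insert i J - insert i A = J - A" and "finite A" and "i \<notin> A"
      using assms by (auto intro: finite_subset)
    then show "?w (insert i J) (insert i A) =
        q i * ((\<Prod>i\<in>A. q i) * (\<Prod>i\<in>J - A. 1 - q i) * f (Suc (card A)))"
      by simp
  qed
  finally show ?thesis by simp
qed

lemma poisbin_const:
  assumes "finite J"
  shows "poisbin J q (\<lambda>_. c) = c"
  using assms by (induction J rule: finite_induct) (auto simp: poisbin_insert algebra_simps)

lemma abs_poisbin_le:
  assumes "finite J" and "\<And>i. i \<in> J \<Longrightarrow> q i \<in> {0..1}" and "\<And>k. \<bar>f k\<bar> \<le> C"
  shows "\<bar>poisbin J q f\<bar> \<le> C"
  using assms
proof (induction J arbitrary: f rule: finite_induct)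
  case empty
  then show ?case by simp
next
  case (insert i J)
  have q: "0 \<le> q i" "q i \<le> 1" using insert.prems by auto
  have "\<bar>poisbin (insert i J) q f\<bar> \<le> q i * \<bar>poisbin J q (\<lambda>k. f (Suc k))\<bar> + (1 - q i) * \<bar>poisbin J q f\<bar>"
    using q unfolding poisbin_insert[OF insert.hyps]
    by (intro order.trans[OF abs_triangle_ineq]) (simp add: abs_mult)
  also have "\<dots> \<le> q i * C + (1 - q i) * C"
    using q insert.prems by (intro add_mono mult_left_mono insert.IH) auto
  finally show ?case by (simp add: algebra_simps)
qed

text \<open>
  Size biasing: in the expectation of \<open>N * g N\<close> the factor \<open>N\<close> is a sum of indicators, and each of
  them forces its own variable to be 1.
\<close>

lemma poisbin_size_bias:
  assumes "finite J"
  shows "poisbin J q (\<lambda>k. real k * g k) = (\<Sum>j\<in>J. q j * poisbin (J - {j}) q (\<lambda>k. g (Suc k)))"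
  using assms
proof (induction J arbitrary: g rule: finite_induct)
  case empty
  then show ?case by simp
next
  case (insert i J)
  have *: "poisbin (insert i J - {j}) q (\<lambda>k. g (Suc k)) =
      q i * poisbin (J - {j}) q (\<lambda>k. g (Suc (Suc k))) + (1 - q i) * poisbin (J - {j}) q (\<lambda>k. g (Suc k))"
    if "j \<in> J" for j
  proof -
    have "insert i J - {j} = insert i (J - {j})" using that insert.hyps by auto
    then show ?thesis using insert.hyps by (simp add: poisbin_insert)
  qed
  have "poisbin J q (\<lambda>k. real (Suc k) * g (Suc k)) = 
      poisbin J q (\<lambda>k. g (Suc k)) + poisbin J q (\<lambda>k. real k * g (Suc k))"
    unfolding poisbin_add[symmetric] by (intro poisbin_cong) (auto simp: algebra_simps)
  then have "poisbin (insert i J) q (\<lambda>k. real k * g k) = q i * poisbin J q (\<lambda>k. g (Suc k)) +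
      (q i * poisbin J q (\<lambda>k. real k * g (Suc k)) + (1 - q i) * poisbin J q (\<lambda>k. real k * g k))"
    by (simp only: poisbin_insert[OF insert.hyps] distrib_left add.assoc)
  also have "q i * poisbin J q (\<lambda>k. real k * g (Suc k)) + (1 - q i) * poisbin J q (\<lambda>k. real k * g k) =
      (\<Sum>j\<in>J. q j * poisbin (insert i J - {j}) q (\<lambda>k. g (Suc k)))"
    unfolding insert.IH sum_distrib_left sum.distrib[symmetric]
    by (intro sum.cong refl) (simp add: * algebra_simps)
  also have "q i * poisbin J q (\<lambda>k. g (Suc k)) = q i * poisbin (insert i J - {i}) q (\<lambda>k. g (Suc k))"
    using insert.hyps by simp
  finally show ?case using insert.hyps by simp
qed

lemma poisbin_remove_diff:
  assumes "finite J" and "j \<in> J"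
  shows "poisbin J q h - poisbin (J - {j}) q h = q j * poisbin (J - {j}) q (\<lambda>m. h (Suc m) - h m)"
  using assms poisbin_insert[of "J - {j}" j q h]
  by (simp add: insert_absorb poisbin_diff algebra_simps)

text \<open>
  Two independent sums that differ only in this: the first has the variables \<open>j\<close> and \<open>k\<close>, the second
  has no variable \<open>j\<close> and a changed success probability at \<open>k\<close>. Conditioning on the common part, the
  difference is a combination of the first two increments of \<open>h\<close>.
\<close>

lemma poisbin_exchange_diff:
  assumes "finite J" and "j \<in> J" and "k \<in> J" and "j \<noteq> k"
    and "\<And>i. i \<in> J - {j, k} \<Longrightarrow> q' i = q i"
  shows "poisbin J q h - poisbin (J - {j}) q' h =
      (q j + q k - q j * q k - q' k) * poisbin (J - {j, k}) q (\<lambda>m. h (Suc m) - h m) +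
      q j * q k * poisbin (J - {j, k}) q (\<lambda>m. h (Suc (Suc m)) - h (Suc m))"
proof -
  let ?K = "J - {j, k}"
  have J: "J = insert j (insert k ?K)" and Jj: "J - {j} = insert k ?K"
    using assms by auto
  have K: "finite ?K" "k \<notin> ?K" "finite (insert k ?K)" "j \<notin> insert k ?K"
    using assms by auto
  have q': "poisbin ?K q' f = poisbin ?K q f" for f
    using assms(5) by (intro poisbin_cong) auto
  have "poisbin J q h = poisbin (insert j (insert k ?K)) q h" using J by simp
  also have "\<dots> = q j * (q k * poisbin ?K q (\<lambda>m. h (Suc (Suc m))) + (1 - q k) * poisbin ?K q (\<lambda>m. h (Suc m)))
      + (1 - q j) * (q k * poisbin ?K q (\<lambda>m. h (Suc m)) + (1 - q k) * poisbin ?K q h)"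
    by (simp only: poisbin_insert[OF K(1,2)] poisbin_insert[OF K(3,4)])
  finally show ?thesis
    by (simp only: Jj poisbin_insert[OF K(1,2)] q' poisbin_diff) (simp add: algebra_simps)
qed

section \<open>Sums over pairs of distinct indices\<close>

lemma sum_distinct_pairs:
  "(\<Sum>(j, k)\<in>distinct_pairs n. f j k) = (\<Sum>j=1..n. \<Sum>k\<in>{1..n} - {j}. f j k)"
proof -
  have "distinct_pairs n = Sigma {1..n} (\<lambda>j. {1..n} - {j})"
    by (auto simp: distinct_pairs_def)
  then show ?thesis by (simp add: sum.Sigma)
qed

lemma sum_distinct_pairs_diff:
  fixes f :: "nat \<Rightarrow> nat \<Rightarrow> real"
  shows "(\<Sum>(j, k)\<in>distinct_pairs n. f j k) = (\<Sum>j=1..n. \<Sum>k=1..n. f j k) - (\<Sum>j=1..n. f j j)"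
  by (simp add: sum_distinct_pairs sum_diff1 sum_subtractf)

lemma sum_distinct_pairs_swap:
  "(\<Sum>(j, k)\<in>distinct_pairs n. f j k) = (\<Sum>(j, k)\<in>distinct_pairs n. f k j)"
  by (rule sum.reindex_bij_witness[where i = prod.swap and j = prod.swap])
    (auto simp: distinct_pairs_def)

lemma sum_distinct_pairs_fst:
  fixes f :: "nat \<Rightarrow> real"
  shows "(\<Sum>(j, k)\<in>distinct_pairs n. f j) = (real n - 1) * (\<Sum>j=1..n. f j)"
  by (simp add: sum_distinct_pairs_diff left_diff_distrib flip: sum_distrib_left)

lemma distinct_pairs_cong:
  assumes "\<And>j k. j \<in> {1..n} \<Longrightarrow> k \<in> {1..n} \<Longrightarrow> j \<noteq> k \<Longrightarrow> f j k = g j k"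
  shows "(\<Sum>(j, k)\<in>distinct_pairs n. f j k) = (\<Sum>(j, k)\<in>distinct_pairs n. g j k)"
  using assms by (intro sum.cong) (auto simp: distinct_pairs_def)

section \<open>Values of a uniform permutation at one and at two points\<close>

lemma finite_perms [simp]: "finite (perms n)"
  by (simp add: perms_def finite_permutations)

lemma card_perms: "card (perms n) = fact n"
  by (simp add: perms_def card_permutations)

lemma sum_perms_compose:
  assumes "\<tau> permutes {1..n}"
  shows "(\<Sum>\<sigma>\<in>perms n. f \<sigma>) = (\<Sum>\<sigma>\<in>perms n. f (\<sigma> \<circ> \<tau>))"
  unfolding perms_def by (rule sum_permutations_compose_right[OF assms])

lemma permutes_pair_transitive:
  assumes "r \<in> S" "s \<in> S" "r \<noteq> s" "r' \<in> S" "s' \<in> S" "r' \<noteq> s'"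
  obtains \<tau> where "\<tau> permutes S" "\<tau> r = r'" "\<tau> s = s'"
proof
  define t where "t = Transposition.transpose r r' s"
  have t: "t \<in> S" "t \<noteq> r'" using assms by (auto simp: t_def Transposition.transpose_def)
  show "Transposition.transpose t s' \<circ> Transposition.transpose r r' permutes S"
    using assms t by (intro permutes_compose permutes_swap_id)
  show "(Transposition.transpose t s' \<circ> Transposition.transpose r r') r = r'"
    "(Transposition.transpose t s' \<circ> Transposition.transpose r r') s = s'"
    using assms t by (auto simp flip: t_def)
qed

lemma sum_perms_pair_group:
  fixes f :: "nat \<Rightarrow> nat \<Rightarrow> real"
  assumes jk: "j \<in> {1..n}" "k \<in> {1..n}" "j \<noteq> k"
  shows "(\<Sum>\<sigma>\<in>perms n. f (\<sigma> j) (\<sigma> k)) =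
    (\<Sum>(r, s)\<in>distinct_pairs n. real (card {\<sigma> \<in> perms n. \<sigma> j = r \<and> \<sigma> k = s}) * f r s)"
proof -
  have "(\<Sum>\<sigma>\<in>perms n. f (\<sigma> j) (\<sigma> k)) =
      (\<Sum>x\<in>distinct_pairs n. \<Sum>\<sigma>\<in>{\<sigma> \<in> perms n. (\<sigma> j, \<sigma> k) = x}. f (\<sigma> j) (\<sigma> k))"
  proof (rule sum.group[symmetric])
    show "finite (distinct_pairs n)"
      by (rule finite_subset[of _ "{1..n} \<times> {1..n}"]) (auto simp: distinct_pairs_def)
    show "(\<lambda>\<sigma>. (\<sigma> j, \<sigma> k)) ` perms n \<subseteq> distinct_pairs n"
    proof (rule image_subsetI)
      fix \<sigma> assume "\<sigma> \<in> perms n"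
      then have "\<sigma> permutes {1..n}" by (simp add: perms_def)
      then show "(\<sigma> j, \<sigma> k) \<in> distinct_pairs n"
        using jk permutes_in_image[of \<sigma> "{1..n}"] inj_eq[OF permutes_inj, of \<sigma> "{1..n}" j k]
        by (simp add: distinct_pairs_def)
    qed
  qed simp
  also have "\<dots> = (\<Sum>(r, s)\<in>distinct_pairs n. real (card {\<sigma> \<in> perms n. \<sigma> j = r \<and> \<sigma> k = s}) * f r s)"
    by (intro sum.cong refl) (simp add: case_prod_unfold prod_eq_iff)
  finally show ?thesis .
qed

text \<open>
  A uniform permutation maps two distinct points to any two prescribed distinct points with
  probability \<open>1 / (n * (n - 1))\<close>. All these probabilities agree because permutations act
  transitively on pairs of distinct points, and they sum to 1.
\<close>

lemma card_perms_pair: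
  assumes jk: "j \<in> {1..n}" "k \<in> {1..n}" "j \<noteq> k" and rs: "r \<in> {1..n}" "s \<in> {1..n}" "r \<noteq> s"
  shows "real n * (real n - 1) * real (card {\<sigma> \<in> perms n. \<sigma> j = r \<and> \<sigma> k = s}) = fact n"
proof -
  let ?c = "\<lambda>r s. card {\<sigma> \<in> perms n. \<sigma> j = r \<and> \<sigma> k = s}"
  have const: "?c r' s' = ?c r s" if rs': "r' \<in> {1..n}" "s' \<in> {1..n}" "r' \<noteq> s'" for r' s'
  proof -
    obtain \<tau> where \<tau>: "\<tau> permutes {1..n}" "\<tau> r' = r" "\<tau> s' = s"
      by (rule permutes_pair_transitive[OF rs' rs])
    have inv_o: "inv \<tau> \<circ> \<tau> = id" "\<tau> \<circ> inv \<tau> = id"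
      using permutes_inv_o[OF \<tau>(1)] by blast+
    have inv_rs: "inv \<tau> r = r'" "inv \<tau> s = s'"
      unfolding permutes_inv_eq[OF \<tau>(1)] by (rule \<tau>)+
    have perm: "\<tau> \<circ> \<sigma> \<in> perms n" "inv \<tau> \<circ> \<sigma> \<in> perms n" if "\<sigma> \<in> perms n" for \<sigma>
      using that permutes_compose[OF _ \<tau>(1)] permutes_compose[OF _ permutes_inv[OF \<tau>(1)]]
      unfolding perms_def by blast+
    show ?thesis
    proof (rule bij_betw_same_card,
        rule bij_betw_byWitness[where f = "(\<circ>) \<tau>" and f' = "(\<circ>) (inv \<tau>)"])
      show "\<forall>\<sigma>\<in>{\<sigma> \<in> perms n. \<sigma> j = r' \<and> \<sigma> k = s'}. inv \<tau> \<circ> (\<tau> \<circ> \<sigma>) = \<sigma>"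
        by (simp add: inv_o(1) flip: comp_assoc)
      show "\<forall>\<sigma>\<in>{\<sigma> \<in> perms n. \<sigma> j = r \<and> \<sigma> k = s}. \<tau> \<circ> (inv \<tau> \<circ> \<sigma>) = \<sigma>"
        by (simp add: inv_o(2) flip: comp_assoc)
      show "(\<circ>) \<tau> ` {\<sigma> \<in> perms n. \<sigma> j = r' \<and> \<sigma> k = s'} \<subseteq> {\<sigma> \<in> perms n. \<sigma> j = r \<and> \<sigma> k = s}"
        using perm(1) \<tau>(2,3) by auto
      show "(\<circ>) (inv \<tau>) ` {\<sigma> \<in> perms n. \<sigma> j = r \<and> \<sigma> k = s} \<subseteq> {\<sigma> \<in> perms n. \<sigma> j = r' \<and> \<sigma> k = s'}"
        using perm(2) inv_rs by auto
    qed
  qed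
  have "fact n = (\<Sum>\<sigma>\<in>perms n. 1::real)" by (simp add: card_perms)
  also have "\<dots> = (\<Sum>(r', s')\<in>distinct_pairs n. real (?c r' s') * 1)"
    by (rule sum_perms_pair_group[OF jk])
  also have "\<dots> = (\<Sum>(r', s')\<in>distinct_pairs n. real (?c r s))"
  proof (rule distinct_pairs_cong)
    fix r' s' assume "r' \<in> {1..n}" "s' \<in> {1..n}" "r' \<noteq> s'"
    from const[OF this] show "real (?c r' s') * 1 = real (?c r s)" by (simp only: mult_1_right)
  qed
  also have "\<dots> = real n * (real n - 1) * real (?c r s)"
    by (subst sum_distinct_pairs_fst[where f = "\<lambda>_. real (?c r s)"]) simp
  finally show ?thesis by simp
qed

lemma sum_perms_pair:
  fixes f :: "nat \<Rightarrow> nat \<Rightarrow> real"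
  assumes jk: "j \<in> {1..n}" "k \<in> {1..n}" "j \<noteq> k"
  shows "real n * (real n - 1) * (\<Sum>\<sigma>\<in>perms n. f (\<sigma> j) (\<sigma> k)) =
    fact n * (\<Sum>(r, s)\<in>distinct_pairs n. f r s)"
proof -
  have "real n * (real n - 1) * (\<Sum>\<sigma>\<in>perms n. f (\<sigma> j) (\<sigma> k)) =
     (\<Sum>(r, s)\<in>distinct_pairs n.
        real n * (real n - 1) * real (card {\<sigma> \<in> perms n. \<sigma> j = r \<and> \<sigma> k = s}) * f r s)"
    unfolding sum_perms_pair_group[OF jk]
    by (simp add: sum_distrib_left case_prod_unfold mult.assoc)
  also have "\<dots> = (\<Sum>(r, s)\<in>distinct_pairs n. fact n * f r s)"
  proof (rule distinct_pairs_cong)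
    fix r s assume "r \<in> {1..n}" "s \<in> {1..n}" "r \<noteq> s"
    from card_perms_pair[OF jk this]
    show "real n * (real n - 1) * real (card {\<sigma> \<in> perms n. \<sigma> j = r \<and> \<sigma> k = s}) * f r s =
        fact n * f r s"
    by simp
  qed
  finally show ?thesis by (simp add: sum_distrib_left case_prod_unfold)
qed

lemma sum_perms_single:
  fixes f :: "nat \<Rightarrow> real"
  assumes n: "n \<ge> 2" and j: "j \<in> {1..n}"
  shows "real n * (\<Sum>\<sigma>\<in>perms n. f (\<sigma> j)) = fact n * (\<Sum>r=1..n. f r)"
proof -
  \<comment> \<open>A second point, possible as \<open>n \<ge> 2\<close>, so that the law of one value is a marginal of that of a pair.\<close>
  define k where "k = (if j = 1 then 2 else 1 :: nat)"
  have k: "k \<in> {1..n}" "j \<noteq> k" using n j by (auto simp: k_def)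
  have "(real n - 1) * (real n * (\<Sum>\<sigma>\<in>perms n. f (\<sigma> j))) =
      (real n - 1) * (fact n * (\<Sum>r=1..n. f r))"
    using sum_perms_pair[OF j k, of "\<lambda>r _. f r"] by (simp add: sum_distinct_pairs_fst mult_ac)
  then show ?thesis using n by simp
qed

section \<open>The Stein identity for random diagonal sums\<close>

text \<open>
  The contribution of two rows \<open>j\<close>, \<open>k\<close> to the Stein identity, summed over the four ways of
  exchanging \<open>j\<close> with \<open>k\<close> and \<open>\<sigma> j\<close> with \<open>\<sigma> k\<close>. The arguments \<open>x\<close> and \<open>y\<close> stand for the
  expectations of \<open>g (W + 2) - g (W + 1)\<close> and \<open>g (W + 3) - g (W + 2)\<close>, where \<open>W\<close> is the sum over the
  other rows; these do not change under the exchanges.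
\<close>

definition stein_local :: "(nat \<Rightarrow> nat \<Rightarrow> real) \<Rightarrow> (nat \<Rightarrow> nat) \<Rightarrow> nat \<Rightarrow> nat \<Rightarrow> real \<Rightarrow> real \<Rightarrow> real" where
  "stein_local p \<sigma> j k x y =
    (let a = p j (\<sigma> k); b = p j (\<sigma> j); c = p k (\<sigma> k); d = p k (\<sigma> j);
         t = a * b * (c + d) + c * d * (a + b)
     in (2 * (a * b + c * d) + 2 * ((a - b) * (c - d)) - t) * x + t * y)"

text \<open>
  The exact form of \<open>E (\<lambda> g(S + 1) - S g(S))\<close>, multiplied by \<open>n * n!\<close>, where \<open>\<lambda>\<close> is the
  sum of all entries divided by \<open>n\<close>. After size biasing in row
  \<open>j\<close>, the column \<open>\<sigma> j\<close> of that row is made independent of the rest by composing \<open>\<sigma>\<close> with the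
  transposition of \<open>j\<close> and a further row \<open>k\<close>. The resulting difference only involves the rows
  \<open>j\<close> and \<open>k\<close>; the case \<open>k = j\<close> gives the first sum, the others give the second.
\<close>

lemma stein_identity:
  fixes p :: "nat \<Rightarrow> nat \<Rightarrow> real" and g :: "nat \<Rightarrow> real" and n :: nat
  defines "\<Delta> \<equiv> \<lambda>m. g (Suc (Suc m)) - g (Suc m)"
  defines "Q \<equiv> \<lambda>\<sigma> J. poisbin ({1..n} - J) (\<lambda>i. p i (\<sigma> i))"
  shows "(\<Sum>\<sigma>\<in>perms n. (\<Sum>j=1..n. \<Sum>r=1..n. p j r) * Q \<sigma> {} (\<lambda>k. g (Suc k)) -
      real n * Q \<sigma> {} (\<lambda>k. real k * g k)) =
    (\<Sum>j=1..n. \<Sum>\<sigma>\<in>perms n. (p j (\<sigma> j))\<^sup>2 * Q \<sigma> {j} \<Delta>) +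
    1 / 4 * (\<Sum>(j, k)\<in>distinct_pairs n. \<Sum>\<sigma>\<in>perms n.
       stein_local p \<sigma> j k (Q \<sigma> {j, k} \<Delta>) (Q \<sigma> {j, k} (\<lambda>m. \<Delta> (Suc m))))"
proof -
  define h where "h = (\<lambda>k. g (Suc k))"
  define F where "F = (\<lambda>\<sigma> j k. p j (\<sigma> k) * (Q \<sigma> {} h - Q (\<sigma> \<circ> Transposition.transpose j k) {j} h))"
  have transp: "Transposition.transpose j k permutes {1..n}" if "j \<in> {1..n}" "k \<in> {1..n}" for j k
    using that by (rule permutes_swap_id)
  have perm: "\<sigma> permutes {1..n}" if "\<sigma> \<in> perms n" for \<sigma>
    using that by (simp add: perms_def)
  \<comment> \<open>As \<open>k\<close> runs over the rows, \<open>\<sigma> k\<close> runs over all columns.\<close>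
  have 1: "(\<Sum>\<sigma>\<in>perms n. (\<Sum>j=1..n. \<Sum>r=1..n. p j r) * Q \<sigma> {} h) =
      (\<Sum>j=1..n. \<Sum>k=1..n. \<Sum>\<sigma>\<in>perms n. p j (\<sigma> k) * Q \<sigma> {} h)"
  proof -
    have "(\<Sum>j=1..n. \<Sum>r=1..n. p j r) * Q \<sigma> {} h = (\<Sum>j=1..n. \<Sum>k=1..n. p j (\<sigma> k) * Q \<sigma> {} h)"
      if "\<sigma> \<in> perms n" for \<sigma>
      unfolding sum_distrib_right
    proof (rule sum.cong)
      fix j
      show "(\<Sum>r=1..n. p j r * Q \<sigma> {} h) = (\<Sum>k=1..n. p j (\<sigma> k) * Q \<sigma> {} h)"
        using sum.permute[OF perm[OF that], of "\<lambda>r. p j r * Q \<sigma> {} h"] by (simp add: o_def)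
    qed simp
    then show ?thesis
      by (simp add: sum.swap[of _ _ "perms n"] cong: sum.cong)
  qed
  \<comment> \<open>The factor \<open>n\<close> becomes a sum over \<open>k\<close>; in its \<open>k\<close>-th term \<open>\<sigma>\<close> is composed with a transposition.\<close>
  have 2: "(\<Sum>\<sigma>\<in>perms n. real n * Q \<sigma> {} (\<lambda>k. real k * g k)) =
      (\<Sum>j=1..n. \<Sum>k=1..n. \<Sum>\<sigma>\<in>perms n. p j (\<sigma> k) * Q (\<sigma> \<circ> Transposition.transpose j k) {j} h)"
  proof -
    have "(\<Sum>\<sigma>\<in>perms n. real n * Q \<sigma> {} (\<lambda>k. real k * g k)) =
        (\<Sum>\<sigma>\<in>perms n. \<Sum>j=1..n. real n * (p j (\<sigma> j) * Q \<sigma> {j} h))"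
      by (simp add: Q_def poisbin_size_bias h_def sum_distrib_left)
    also have "\<dots> = (\<Sum>j=1..n. \<Sum>k=1..n. \<Sum>\<sigma>\<in>perms n. p j (\<sigma> j) * Q \<sigma> {j} h)"
      by (subst sum.swap) (simp add: sum_distrib_left)
    also have "\<dots> = (\<Sum>j=1..n. \<Sum>k=1..n. \<Sum>\<sigma>\<in>perms n.
        p j (\<sigma> k) * Q (\<sigma> \<circ> Transposition.transpose j k) {j} h)"
    proof (rule sum.cong[OF refl], rule sum.cong[OF refl])
      fix j k assume "j \<in> {1..n}" "k \<in> {1..n}"
      from sum_perms_compose[OF transp[OF this], of "\<lambda>\<sigma>. p j (\<sigma> j) * Q \<sigma> {j} h"]
      show "(\<Sum>\<sigma>\<in>perms n. p j (\<sigma> j) * Q \<sigma> {j} h) =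
          (\<Sum>\<sigma>\<in>perms n. p j (\<sigma> k) * Q (\<sigma> \<circ> Transposition.transpose j k) {j} h)"
        by simp
    qed
    finally show ?thesis .
  qed
  have "(\<Sum>\<sigma>\<in>perms n. (\<Sum>j=1..n. \<Sum>r=1..n. p j r) * Q \<sigma> {} h -
      real n * Q \<sigma> {} (\<lambda>k. real k * g k)) = (\<Sum>j=1..n. \<Sum>k=1..n. \<Sum>\<sigma>\<in>perms n. F \<sigma> j k)"
    unfolding sum_subtractf 1 2 F_def right_diff_distrib by simp
  also have "\<dots> = (\<Sum>j=1..n. \<Sum>\<sigma>\<in>perms n. F \<sigma> j j) +
      (\<Sum>(j, k)\<in>distinct_pairs n. \<Sum>\<sigma>\<in>perms n. F \<sigma> j k)"
    unfolding sum_distinct_pairs_diff by simp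
  also have "(\<Sum>j=1..n. \<Sum>\<sigma>\<in>perms n. F \<sigma> j j) =
      (\<Sum>j=1..n. \<Sum>\<sigma>\<in>perms n. (p j (\<sigma> j))\<^sup>2 * Q \<sigma> {j} \<Delta>)"
  proof (intro sum.cong refl)
    fix j \<sigma> assume "j \<in> {1..n}"
    then show "F \<sigma> j j = (p j (\<sigma> j))\<^sup>2 * Q \<sigma> {j} \<Delta>"
      using poisbin_remove_diff[of "{1..n}" j "\<lambda>i. p i (\<sigma> i)" h]
      by (simp add: F_def Q_def \<Delta>_def h_def power2_eq_square)
  qed
  also have "(\<Sum>(j, k)\<in>distinct_pairs n. \<Sum>\<sigma>\<in>perms n. F \<sigma> j k) =
      1 / 4 * (\<Sum>(j, k)\<in>distinct_pairs n. \<Sum>\<sigma>\<in>perms n.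
        stein_local p \<sigma> j k (Q \<sigma> {j, k} \<Delta>) (Q \<sigma> {j, k} (\<lambda>m. \<Delta> (Suc m))))"
  proof -
    define T where "T = (\<lambda>f. \<Sum>(j, k)\<in>distinct_pairs n. \<Sum>\<sigma>\<in>perms n. f \<sigma> j k :: real)"
    have swap: "T f = T (\<lambda>\<sigma> j k. f \<sigma> k j)" for f
      unfolding T_def by (rule sum_distinct_pairs_swap)
    have compose: "T f = T (\<lambda>\<sigma> j k. f (\<sigma> \<circ> Transposition.transpose j k) j k)" for f
      unfolding T_def by (intro distinct_pairs_cong sum_perms_compose transp)
    have F: "F \<sigma> j k = p j (\<sigma> k) * ((p j (\<sigma> j) + p k (\<sigma> k) - p j (\<sigma> j) * p k (\<sigma> k) - p k (\<sigma> j)) *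
        Q \<sigma> {j, k} \<Delta> + p j (\<sigma> j) * p k (\<sigma> k) * Q \<sigma> {j, k} (\<lambda>m. \<Delta> (Suc m)))"
      if "j \<in> {1..n}" "k \<in> {1..n}" "j \<noteq> k" for \<sigma> j k
      unfolding F_def
      using poisbin_exchange_diff[OF _ that, of "\<lambda>i. p i ((\<sigma> \<circ> Transposition.transpose j k) i)"
          "\<lambda>i. p i (\<sigma> i)" h]
      by (simp add: Q_def \<Delta>_def h_def)
    have Q: "Q (\<sigma> \<circ> Transposition.transpose j k) {j, k} f = Q \<sigma> {j, k} f" for \<sigma> j k f
      unfolding Q_def by (rule poisbin_cong) auto
    \<comment> \<open>Averaging over the four exchanges, none of which changes the total sum.\<close>
    have "4 * T F = T F + T (\<lambda>\<sigma> j k. F \<sigma> k j) + T (\<lambda>\<sigma> j k. F (\<sigma> \<circ> Transposition.transpose j k) j k) +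
        T (\<lambda>\<sigma> j k. F (\<sigma> \<circ> Transposition.transpose j k) k j)"
      using swap[of F] compose[of F] compose[of "\<lambda>\<sigma> j k. F \<sigma> k j"] by simp
    also have "\<dots> = T (\<lambda>\<sigma> j k. F \<sigma> j k + F \<sigma> k j + F (\<sigma> \<circ> Transposition.transpose j k) j k +
        F (\<sigma> \<circ> Transposition.transpose j k) k j)"
      unfolding T_def by (simp add: sum.distrib case_prod_unfold)
    also have "\<dots> = T (\<lambda>\<sigma> j k. stein_local p \<sigma> j k (Q \<sigma> {j, k} \<Delta>) (Q \<sigma> {j, k} (\<lambda>m. \<Delta> (Suc m))))"
      unfolding T_def
    proof (intro distinct_pairs_cong sum.cong refl)
      fix j k \<sigma> assume jk: "j \<in> {1..n}" "k \<in> {1..n}" "j \<noteq> k"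
      show "F \<sigma> j k + F \<sigma> k j + F (\<sigma> \<circ> Transposition.transpose j k) j k +
          F (\<sigma> \<circ> Transposition.transpose j k) k j =
        stein_local p \<sigma> j k (Q \<sigma> {j, k} \<Delta>) (Q \<sigma> {j, k} (\<lambda>m. \<Delta> (Suc m)))"
        unfolding F[OF jk] F[OF jk(2,1) jk(3)[symmetric]] insert_commute[of k j] Q
          stein_local_def Let_def by (simp add: algebra_simps)
    qed
    finally show ?thesis unfolding T_def by simp
  qed
  finally show ?thesis by (simp add: h_def)
qed

section \<open>Averages over permutations and the three quantities gamma\<close>

text \<open>
  Averaging the terms of the Stein identity over the permutations. The choice of \<open>\<psi>\<close> as the absolute
  value leads to \<open>gamma2\<close>, the identity function to the variance.
\<close>

lemma perm_average_reduction:
  fixes p :: "nat \<Rightarrow> nat \<Rightarrow> real" and \<psi> :: "real \<Rightarrow> real"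
  assumes n: "n \<ge> 2"
  shows "((\<Sum>j=1..n. \<Sum>\<sigma>\<in>perms n. (p j (\<sigma> j))\<^sup>2) +
      1 / 4 * (\<Sum>(j, k)\<in>distinct_pairs n. \<Sum>\<sigma>\<in>perms n.
        2 * (p j (\<sigma> k) * p j (\<sigma> j) + p k (\<sigma> k) * p k (\<sigma> j)) +
        2 * \<psi> ((p j (\<sigma> k) - p j (\<sigma> j)) * (p k (\<sigma> k) - p k (\<sigma> j))))) / (real n * fact n) =
    (\<Sum>j=1..n. (row_mean n p j)\<^sup>2) +
      1 / (2 * (real n)\<^sup>2 * (real n - 1)) * (\<Sum>(j, k)\<in>distinct_pairs n. \<Sum>(r, s)\<in>distinct_pairs n.
        \<psi> ((p j r - p j s) * (p k r - p k s)))"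
proof -
  define U where "U = (\<Sum>j=1..n. \<Sum>r=1..n. (p j r)\<^sup>2)"
  define V where "V = (\<Sum>j=1..n. \<Sum>(r, s)\<in>distinct_pairs n. p j r * p j s)"
  define W where "W = (\<Sum>(j, k)\<in>distinct_pairs n. \<Sum>(r, s)\<in>distinct_pairs n.
    \<psi> ((p j r - p j s) * (p k r - p k s)))"
  have n0: "real n > 0" "real n - 1 > 0" using n by auto
  have 1: "(\<Sum>j=1..n. \<Sum>\<sigma>\<in>perms n. (p j (\<sigma> j))\<^sup>2) = fact n / n * U"
  proof -
    have "real n * (\<Sum>j=1..n. \<Sum>\<sigma>\<in>perms n. (p j (\<sigma> j))\<^sup>2) = fact n * U"
      unfolding U_def sum_distrib_left
      by (intro sum.cong refl)
        (simp add: sum_perms_single[OF n, where f = "\<lambda>r. (p _ r)\<^sup>2"] flip: sum_distrib_left)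
    then show ?thesis using n0 by (simp add: field_simps)
  qed
  have 2: "(\<Sum>(j, k)\<in>distinct_pairs n. \<Sum>\<sigma>\<in>perms n.
        2 * (p j (\<sigma> k) * p j (\<sigma> j) + p k (\<sigma> k) * p k (\<sigma> j)) +
        2 * \<psi> ((p j (\<sigma> k) - p j (\<sigma> j)) * (p k (\<sigma> k) - p k (\<sigma> j)))) =
      fact n / (n * (n - 1)) * (4 * (real n - 1) * V + 2 * W)"
  proof -
    have "(\<Sum>(j, k)\<in>distinct_pairs n. \<Sum>\<sigma>\<in>perms n.
        2 * (p j (\<sigma> k) * p j (\<sigma> j) + p k (\<sigma> k) * p k (\<sigma> j)) +
        2 * \<psi> ((p j (\<sigma> k) - p j (\<sigma> j)) * (p k (\<sigma> k) - p k (\<sigma> j)))) =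
      (\<Sum>(j, k)\<in>distinct_pairs n. fact n / (n * (n - 1)) * (\<Sum>(r, s)\<in>distinct_pairs n.
        2 * (p j r * p j s + p k r * p k s) + 2 * \<psi> ((p j r - p j s) * (p k r - p k s))))"
    proof (rule distinct_pairs_cong)
      fix j k assume jk: "j \<in> {1..n}" "k \<in> {1..n}" "j \<noteq> k"
      define f where "f = (\<lambda>r s. 2 * (p j r * p j s + p k r * p k s) +
        2 * \<psi> ((p j r - p j s) * (p k r - p k s)))"
      have "(\<Sum>\<sigma>\<in>perms n. f (\<sigma> k) (\<sigma> j)) =
          fact n / (n * (n - 1)) * (\<Sum>(r, s)\<in>distinct_pairs n. f r s)"
        using sum_perms_pair[OF jk(2,1) jk(3)[symmetric], of f] n0 n
        by (simp add: field_simps of_nat_diff)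
      then show "(\<Sum>\<sigma>\<in>perms n. 2 * (p j (\<sigma> k) * p j (\<sigma> j) + p k (\<sigma> k) * p k (\<sigma> j)) +
        2 * \<psi> ((p j (\<sigma> k) - p j (\<sigma> j)) * (p k (\<sigma> k) - p k (\<sigma> j)))) =
        fact n / (n * (n - 1)) * (\<Sum>(r, s)\<in>distinct_pairs n.
        2 * (p j r * p j s + p k r * p k s) + 2 * \<psi> ((p j r - p j s) * (p k r - p k s)))"
        unfolding f_def .
    qed
    also have "\<dots> = fact n / (n * (n - 1)) *
        (2 * ((\<Sum>(j, k)\<in>distinct_pairs n. \<Sum>(r, s)\<in>distinct_pairs n. p j r * p j s) +
         (\<Sum>(j, k)\<in>distinct_pairs n. \<Sum>(r, s)\<in>distinct_pairs n. p k r * p k s)) + 2 * W)"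
      unfolding W_def by (simp add: sum.distrib sum_distrib_left case_prod_unfold distrib_left)
    also have "(\<Sum>(j, k)\<in>distinct_pairs n. \<Sum>(r, s)\<in>distinct_pairs n. p k r * p k s) =
        (\<Sum>(j, k)\<in>distinct_pairs n. \<Sum>(r, s)\<in>distinct_pairs n. p j r * p j s)"
      by (rule sum_distinct_pairs_swap)
    also have "\<dots> = (real n - 1) * V"
      unfolding V_def by (rule sum_distinct_pairs_fst)
    finally show ?thesis by simp
  qed
  have 3: "(\<Sum>j=1..n. (row_mean n p j)\<^sup>2) = (U + V) / (real n)\<^sup>2"
  proof -
    have "(row_mean n p j)\<^sup>2 =
        ((\<Sum>r=1..n. (p j r)\<^sup>2) + (\<Sum>(r, s)\<in>distinct_pairs n. p j r * p j s)) / (real n)\<^sup>2" for j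
      unfolding sum_distinct_pairs_diff row_mean_def
      by (simp add: power_mult_distrib power_divide power2_eq_square sum_product)
    then show ?thesis
      by (simp add: U_def V_def sum.distrib sum_divide_distrib add_divide_distrib)
  qed
  show ?thesis
    unfolding 1 2 3 W_def[symmetric] using n0 n
    by (simp add: field_simps of_nat_diff power2_eq_square)
qed

text \<open>
  Averaging over the exchange of \<open>r\<close> and \<open>s\<close> turns the products of positive parts into negative
  parts of products:
  \<open>x\<^sub>+ (-z)\<^sub>+ + (-x)\<^sub>+ z\<^sub>+ = (\<bar>x z\<bar> - x z) / 2\<close>.
\<close>

lemma gamma1_eq:
  "gamma1 n p = gamma2 n p - 1 / (2 * (real n)\<^sup>2 * (real n - 1)) *
    (\<Sum>(j, k)\<in>distinct_pairs n. \<Sum>(r, s)\<in>distinct_pairs n. (p j r - p j s) * (p k r - p k s))"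
proof -
  have split: "4 * (\<Sum>(r, s)\<in>distinct_pairs n. max 0 (p j r - p j s) * max 0 (p k s - p k r)) =
      (\<Sum>(r, s)\<in>distinct_pairs n. \<bar>p j r - p j s\<bar> * \<bar>p k r - p k s\<bar>) -
      (\<Sum>(r, s)\<in>distinct_pairs n. (p j r - p j s) * (p k r - p k s))" (is "4 * ?m = _") for j k
  proof -
    have "4 * ?m = 2 * (?m + (\<Sum>(r, s)\<in>distinct_pairs n. max 0 (p j s - p j r) * max 0 (p k r - p k s)))"
      using sum_distinct_pairs_swap[of "\<lambda>r s. max 0 (p j r - p j s) * max 0 (p k s - p k r)" n] by simp
    also have "\<dots> = (\<Sum>(r, s)\<in>distinct_pairs n. 2 * (max 0 (p j r - p j s) * max 0 (p k s - p k r) +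
        max 0 (p j s - p j r) * max 0 (p k r - p k s)))"
      by (simp add: sum.distrib sum_distrib_left case_prod_unfold)
    also have "\<dots> = (\<Sum>(r, s)\<in>distinct_pairs n. \<bar>p j r - p j s\<bar> * \<bar>p k r - p k s\<bar> -
        (p j r - p j s) * (p k r - p k s))"
    proof (rule distinct_pairs_cong)
      fix r s
      have "2 * (max 0 x * max 0 (- z) + max 0 (- x) * max 0 z) = \<bar>x\<bar> * \<bar>z\<bar> - x * z" for x z :: real
        by (cases "x \<ge> 0"; cases "z \<ge> 0") (auto simp: max_def)
      from this[of "p j r - p j s" "p k r - p k s"]
      show "2 * (max 0 (p j r - p j s) * max 0 (p k s - p k r) +
          max 0 (p j s - p j r) * max 0 (p k r - p k s)) =
          \<bar>p j r - p j s\<bar> * \<bar>p k r - p k s\<bar> - (p j r - p j s) * (p k r - p k s)"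
        by simp
    qed
    finally show ?thesis by (simp add: sum_subtractf case_prod_unfold)
  qed
  have "4 * (\<Sum>(j, k)\<in>distinct_pairs n. \<Sum>(r, s)\<in>distinct_pairs n.
        max 0 (p j r - p j s) * max 0 (p k s - p k r)) =
      (\<Sum>(j, k)\<in>distinct_pairs n. 4 * (\<Sum>(r, s)\<in>distinct_pairs n.
        max 0 (p j r - p j s) * max 0 (p k s - p k r)))"
    by (simp add: sum_distrib_left case_prod_unfold)
  also have "\<dots> = (\<Sum>(j, k)\<in>distinct_pairs n.
        (\<Sum>(r, s)\<in>distinct_pairs n. \<bar>p j r - p j s\<bar> * \<bar>p k r - p k s\<bar>) -
        (\<Sum>(r, s)\<in>distinct_pairs n. (p j r - p j s) * (p k r - p k s)))"
    unfolding split ..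
  also have "\<dots> = (\<Sum>(j, k)\<in>distinct_pairs n. \<Sum>(r, s)\<in>distinct_pairs n. \<bar>p j r - p j s\<bar> * \<bar>p k r - p k s\<bar>) -
      (\<Sum>(j, k)\<in>distinct_pairs n. \<Sum>(r, s)\<in>distinct_pairs n. (p j r - p j s) * (p k r - p k s))"
    by (simp add: sum_subtractf case_prod_unfold)
  finally have "(\<Sum>(j, k)\<in>distinct_pairs n. \<Sum>(r, s)\<in>distinct_pairs n.
        max 0 (p j r - p j s) * max 0 (p k s - p k r)) =
      ((\<Sum>(j, k)\<in>distinct_pairs n. \<Sum>(r, s)\<in>distinct_pairs n. \<bar>p j r - p j s\<bar> * \<bar>p k r - p k s\<bar>) -
      (\<Sum>(j, k)\<in>distinct_pairs n. \<Sum>(r, s)\<in>distinct_pairs n. (p j r - p j s) * (p k r - p k s))) / 4"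
    by simp
  moreover have "2 / M * ((x - y) / 4) = 1 / (2 * M) * x - 1 / (2 * M) * y" for M x y :: real
    by (simp add: diff_divide_distrib)
  ultimately show ?thesis
    unfolding gamma1_def gamma2_def by (simp only: mult.assoc)
qed

lemma gamma3_eq:
  assumes n: "n \<ge> 2"
  shows "gamma3 n p = 1 / real n * (\<Sum>j=1..n. \<Sum>r=1..n. (p j r)\<^sup>2) -
    (\<Sum>j=1..n. (row_mean n p j)\<^sup>2) - gamma2 n p"
proof -
  define U where "U = (\<Sum>j=1..n. \<Sum>r=1..n. (p j r)\<^sup>2)"
  define R where "R = (\<Sum>j=1..n. (row_mean n p j)\<^sup>2)"
  define G where "G = (\<Sum>(j, k)\<in>distinct_pairs n. \<Sum>(r, s)\<in>distinct_pairs n.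
    \<bar>p j r - p j s\<bar> * \<bar>p k r - p k s\<bar>)"
  have n0: "real n > 0" "real n - 1 > 0" using n by auto
  have row: "(\<Sum>(r, s)\<in>distinct_pairs n. (p j r - p j s)\<^sup>2) =
      2 * real n * (\<Sum>r=1..n. (p j r)\<^sup>2) - 2 * (real n)\<^sup>2 * (row_mean n p j)\<^sup>2" for j
  proof -
    have "(\<Sum>r=1..n. p j r) = real n * row_mean n p j"
      using n0 by (simp add: row_mean_def)
    then have "(\<Sum>r=1..n. p j r)\<^sup>2 = (real n)\<^sup>2 * (row_mean n p j)\<^sup>2"
      by (simp add: power_mult_distrib)
    then have sq: "(\<Sum>r=1..n. \<Sum>s=1..n. p j r * p j s) = (real n)\<^sup>2 * (row_mean n p j)\<^sup>2"
      by (simp only: power2_eq_square sum_product)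
    have "(\<Sum>(r, s)\<in>distinct_pairs n. (p j r - p j s)\<^sup>2) =
        (\<Sum>r=1..n. \<Sum>s=1..n. (p j r - p j s)\<^sup>2)"
      by (simp add: sum_distinct_pairs_diff)
    also have "\<dots> = (\<Sum>r=1..n. \<Sum>s=1..n. (p j r)\<^sup>2 + (p j s)\<^sup>2 - 2 * (p j r * p j s))"
      by (simp only: power2_diff mult.assoc)
    also have "\<dots> = 2 * real n * (\<Sum>r=1..n. (p j r)\<^sup>2) - 2 * (\<Sum>r=1..n. \<Sum>s=1..n. p j r * p j s)"
      by (simp add: sum.distrib sum_subtractf flip: sum_distrib_left)
    finally show ?thesis by (simp only: sq mult.assoc)
  qed
  have D: "(\<Sum>(j, k)\<in>distinct_pairs n. \<Sum>(r, s)\<in>distinct_pairs n. (p j r - p j s)\<^sup>2) =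
      (real n - 1) * (2 * real n * U - 2 * (real n)\<^sup>2 * R)"
    unfolding row sum_distinct_pairs_fst by (simp add: U_def R_def sum_subtractf sum_distrib_left)
  have square: "(\<bar>x\<bar> - \<bar>z\<bar>)\<^sup>2 = x\<^sup>2 + z\<^sup>2 - 2 * (\<bar>x\<bar> * \<bar>z\<bar>)" for x z :: real
    by (simp add: power2_diff)
  have "(\<Sum>(j, k)\<in>distinct_pairs n. \<Sum>(r, s)\<in>distinct_pairs n.
        (\<bar>p j r - p j s\<bar> - \<bar>p k r - p k s\<bar>)\<^sup>2) =
      (\<Sum>(j, k)\<in>distinct_pairs n. \<Sum>(r, s)\<in>distinct_pairs n. (p j r - p j s)\<^sup>2) +
      (\<Sum>(j, k)\<in>distinct_pairs n. \<Sum>(r, s)\<in>distinct_pairs n. (p k r - p k s)\<^sup>2) - 2 * G"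
    unfolding G_def square
    by (simp add: sum.distrib sum_subtractf sum_distrib_left case_prod_unfold)
  also have "(\<Sum>(j, k)\<in>distinct_pairs n. \<Sum>(r, s)\<in>distinct_pairs n. (p k r - p k s)\<^sup>2) =
      (\<Sum>(j, k)\<in>distinct_pairs n. \<Sum>(r, s)\<in>distinct_pairs n. (p j r - p j s)\<^sup>2)"
    by (rule sum_distinct_pairs_swap)
  finally show ?thesis
    unfolding gamma3_def gamma2_def D G_def[symmetric] U_def[symmetric] R_def[symmetric]
    using n0 by (simp only:) (simp add: field_simps power2_eq_square)
qed

section \<open>The Stein equation of the Poisson distribution\<close>

lemma poisson_pmf_Suc:
  assumes "lam > 0"
  shows "real (Suc k) * pmf (poisson_pmf lam) (Suc k) = lam * pmf (poisson_pmf lam) k"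
  using assms by (simp add: field_simps del: of_nat_Suc)

lemma poisson_cdf_weighted:
  assumes "lam > 0"
  shows "lam * (\<Sum>i<k. pmf (poisson_pmf lam) i) = (\<Sum>i\<le>k. real i * pmf (poisson_pmf lam) i)"
proof (induction k)
  case (Suc k)
  then show ?case
    using poisson_pmf_Suc[OF assms, of k] by (simp add: distrib_left del: pmf_poisson)
qed simp

text \<open>
  With \<open>Z\<close> Poisson distributed, this is \<open>k P(Z > k) \<le> \<lambda> P(Z \<ge> k)\<close>; termwise it follows from
  \<open>\<lambda> P(Z = i) = (i + 1) P(Z = i + 1)\<close>.
\<close>

lemma poisson_tail_ineq:
  assumes lam: "lam > 0"
  defines "P \<equiv> pmf (poisson_pmf lam)"
  shows "real k * (1 - (\<Sum>i\<le>k. P i)) \<le> lam * (1 - (\<Sum>i<k. P i))"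
proof -
  have sums: "P sums 1"
  proof -
    have "(\<lambda>i. inverse (fact i) * lam ^ i) sums exp lam"
      by (rule exp_converges[of lam, unfolded scaleR_conv_of_real of_real_eq_id id_apply])
    from sums_mult2[OF this, of "exp (- lam)"]
    have "(\<lambda>i. inverse (fact i) * lam ^ i * exp (- lam)) sums 1"
      by (simp add: exp_minus)
    also have "(\<lambda>i. inverse (fact i) * lam ^ i * exp (- lam)) = P"
      using lam by (simp add: fun_eq_iff P_def divide_inverse mult_ac)
    finally show ?thesis .
  qed
  have tail: "(\<lambda>i. P (i + m)) sums (1 - (\<Sum>i<m. P i))" for m
    using sums by (rule sums_split_initial_segment)
  have "(\<lambda>i. real k * P (i + Suc k)) sums (real k * (1 - (\<Sum>i\<le>k. P i)))"
    using sums_mult[OF tail[of "Suc k"]] by (simp add: lessThan_Suc_atMost)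
  moreover have "(\<lambda>i. lam * P (i + k)) sums (lam * (1 - (\<Sum>i<k. P i)))"
    by (rule sums_mult[OF tail])
  moreover have "real k * P (i + Suc k) \<le> lam * P (i + k)" for i
    using poisson_pmf_Suc[OF lam, of "i + k"] unfolding P_def[symmetric]
    by (simp add: P_def mult_right_mono del: pmf_poisson flip: poisson_pmf_Suc[OF lam])
  ultimately show ?thesis by (rule sums_le[rotated 1])
qed

text \<open>
  The solution of the Stein equation of the Poisson distribution for the indicator of \<open>A\<close>. The value at
  0 is irrelevant for that equation and is set to 0.
\<close>

definition stein_sol :: "real \<Rightarrow> nat set \<Rightarrow> nat \<Rightarrow> real" where
  "stein_sol lam A k = (case k of 0 \<Rightarrow> 0 | Suc m \<Rightarrow>
     (\<Sum>i\<le>m. pmf (poisson_pmf lam) i * (indicator A i - measure (poisson_pmf lam) A)) /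
     (lam * pmf (poisson_pmf lam) m))"

lemma stein_sol_eq:
  assumes lam: "lam > 0"
  shows "lam * stein_sol lam A (Suc k) - real k * stein_sol lam A k =
    indicator A k - measure (poisson_pmf lam) A"
proof -
  define P where "P = pmf (poisson_pmf lam)"
  define d where "d = (\<lambda>i. P i * (indicator A i - measure (poisson_pmf lam) A))"
  have pos: "P i > 0" for i using lam by (simp add: P_def)
  have 1: "lam * stein_sol lam A (Suc m) = (\<Sum>i\<le>m. d i) / P m" for m
    using lam by (simp add: stein_sol_def d_def P_def)
  have 2: "real k * stein_sol lam A k = (\<Sum>i<k. d i) / P k"
  proof (cases k)
    case (Suc m)
    have "stein_sol lam A k = (\<Sum>i<k. d i) / (lam * P m)"
      using Suc by (simp add: stein_sol_def d_def P_def lessThan_Suc_atMost)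
    also have "lam * P m = real k * P k"
      using poisson_pmf_Suc[OF lam, of m] Suc by (simp add: P_def)
    finally show ?thesis using Suc by simp
  qed simp
  have "(\<Sum>i\<le>k. d i) = (\<Sum>i<k. d i) + d k"
    by (simp add: lessThan_Suc_atMost[symmetric])
  then show ?thesis
    unfolding 1 2 using pos[of k] by (simp add: diff_divide_distrib[symmetric] d_def)
qed

lemma stein_sol_Compl: "stein_sol lam (- A) k = - stein_sol lam A k"
proof -
  have "measure (poisson_pmf lam) (- A) = 1 - measure (poisson_pmf lam) A"
    using measure_pmf.prob_compl[of A "poisson_pmf lam"] by (simp add: Compl_eq_Diff_UNIV)
  then have "indicator (- A) i - measure (poisson_pmf lam) (- A) =
      - (indicator A i - measure (poisson_pmf lam) A)" for i
    by (simp add: indicator_def)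
  then show ?thesis
    by (cases k) (simp_all add: stein_sol_def sum_negf del: minus_diff_eq)
qed

text \<open>
  The increment at \<open>k\<close> is a weighted sum of the Poisson masses of \<open>A\<close> below \<open>k\<close>, at \<open>k\<close> and above
  \<open>k\<close>. The weights below and above are at most 0, so only the mass at \<open>k\<close> can contribute positively.
\<close>

lemma stein_sol_increment_le:
  assumes lam: "lam > 0" and k: "k > 0"
  shows "stein_sol lam A (Suc k) - stein_sol lam A k \<le> (1 - exp (- lam)) / lam"
proof -
  define P where "P = pmf (poisson_pmf lam)"
  define Q where "Q = measure (measure_pmf (poisson_pmf lam))"
  define C where "C = (\<Sum>i\<le>k. P i)"
  define C' where "C' = (\<Sum>i<k. P i)"
  define u where "u = Q (A \<inter> {..<k})"
  define v where "v = Q (A \<inter> {k})"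
  define w where "w = Q (A \<inter> {k<..})"
  have pos: "P i > 0" for i using lam by (simp add: P_def)
  have C: "C = C' + P k" by (simp add: C_def C'_def lessThan_Suc_atMost[symmetric])
  have Q: "Q A = u + v + w"
  proof -
    have "A = (A \<inter> {..<k} \<union> A \<inter> {k}) \<union> A \<inter> {k<..}" by auto
    then have "Q A = Q ((A \<inter> {..<k} \<union> A \<inter> {k}) \<union> A \<inter> {k<..})" by simp
    also have "\<dots> = Q (A \<inter> {..<k} \<union> A \<inter> {k}) + w"
      unfolding Q_def w_def by (rule measure_pmf.finite_measure_Union) auto
    also have "Q (A \<inter> {..<k} \<union> A \<inter> {k}) = u + v"
      unfolding Q_def u_def v_def by (rule measure_pmf.finite_measure_Union) auto
    finally show ?thesis .
  qed
  have nonneg: "0 \<le> u" "0 \<le> v" "0 \<le> w" by (simp_all add: u_def v_def w_def Q_def)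
  have v: "v \<le> P k"
    unfolding v_def Q_def P_def by (subst measure_pmf_single[symmetric]) 
      (rule measure_pmf.finite_measure_mono, auto)
  have part: "(\<Sum>i\<in>I. P i * indicator A i) = Q (A \<inter> I)" if "finite I" for I
    using that unfolding Q_def P_def
    by (subst measure_measure_pmf_finite) (auto simp: indicator_def if_distrib sum.inter_restrict
        Int_commute cong: if_cong)
  have "A \<inter> {..k} = A \<inter> {..<k} \<union> A \<inter> {k}" by auto
  then have "Q (A \<inter> {..k}) = Q (A \<inter> {..<k} \<union> A \<inter> {k})" by simp
  also have "\<dots> = u + v"
    unfolding Q_def u_def v_def by (rule measure_pmf.finite_measure_Union) auto
  finally have uv: "Q (A \<inter> {..k}) = u + v" .
  have g1: "stein_sol lam A (Suc k) = (u + v - C * Q A) / (lam * P k)"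
    using part[of "{..k}"] uv
    by (simp only: stein_sol_def nat.case right_diff_distrib sum_subtractf C_def sum_distrib_right
        finite_atMost flip: P_def Q_def)
  have g0: "stein_sol lam A k = (u - C' * Q A) / (real k * P k)"
  proof -
    obtain m where m: "k = Suc m" using k by (cases k) auto
    have "stein_sol lam A k = (u - C' * Q A) / (lam * P m)"
      using part[of "{..m}"]
      by (simp only: m stein_sol_def nat.case right_diff_distrib sum_subtractf C'_def u_def
          sum_distrib_right lessThan_Suc_atMost finite_atMost flip: P_def Q_def)
    then show ?thesis using poisson_pmf_Suc[OF lam, of m] by (simp add: P_def m)
  qed
  have CC': "lam * C' = (\<Sum>i\<le>k. real i * P i)"
    unfolding C'_def P_def by (rule poisson_cdf_weighted[OF lam])
  have 1: "lam * C' \<le> k * C"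
    unfolding CC' C_def sum_distrib_left using less_imp_le[OF pos] 
    by (intro sum_mono mult_right_mono) auto
  have 2: "k * (1 - C) \<le> lam * (1 - C')"
    unfolding C_def C'_def P_def by (rule poisson_tail_ineq[OF lam])
  have 3: "lam * C' \<le> k * (C - exp (- lam))"
  proof -
    have "{..k} = insert 0 {1..k}" by auto
    then have "C = P 0 + (\<Sum>i=1..k. P i)" and "lam * C' = (\<Sum>i=1..k. real i * P i)"
      unfolding CC' C_def by simp_all
    moreover have "(\<Sum>i=1..k. real i * P i) \<le> (\<Sum>i=1..k. real k * P i)"
      using less_imp_le[OF pos] by (intro sum_mono mult_right_mono) auto
    moreover have "P 0 = exp (- lam)" using lam by (simp add: P_def)
    ultimately show ?thesis by (simp add: sum_distrib_left)
  qed
  \<comment> \<open>Facts 2, 3 and 1 bound the weights below, at and above \<open>k\<close> respectively.\<close>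
  have kpos: "real k > 0" using k by simp
  have "lam * k * P k * (stein_sol lam A (Suc k) - stein_sol lam A k) =
      k * (u + v - C * Q A) - lam * (u - C' * Q A)"
    unfolding g1 g0 using lam kpos pos[of k] by (simp add: field_simps)
  also have "\<dots> = u * (k * (1 - C) - lam * (1 - C')) + v * (k * (1 - C) + lam * C')
      + w * (lam * C' - k * C)"
    unfolding Q by (simp add: algebra_simps)
  also have "\<dots> \<le> 0 + v * (k * (1 - exp (- lam))) + 0"
  proof (intro add_mono mult_nonneg_nonpos mult_left_mono nonneg)
    show "k * (1 - C) + lam * C' \<le> k * (1 - exp (- lam))"
      using 3 by (simp add: algebra_simps)
  qed (use 1 2 in auto)
  also have "\<dots> \<le> P k * (k * (1 - exp (- lam)))"
    using v lam by (simp add: mult_right_mono)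
  finally have "lam * k * P k * (stein_sol lam A (Suc k) - stein_sol lam A k) \<le>
    lam * k * P k * ((1 - exp (- lam)) / lam)"
    using lam by (simp add: mult_ac)
  then show ?thesis using lam kpos pos[of k] by (simp add: pos_le_divide_eq mult.commute)
qed

text \<open>
  The lower bound is the upper bound for the complement of \<open>A\<close>, whose solution is the negative one.
\<close>

lemma abs_stein_sol_increment_le:
  assumes "lam > 0" and "k > 0"
  shows "\<bar>stein_sol lam A (Suc k) - stein_sol lam A k\<bar> \<le> (1 - exp (- lam)) / lam"
  using stein_sol_increment_le[OF assms, of A] stein_sol_increment_le[OF assms, of "- A"]
  by (simp add: stein_sol_Compl abs_le_iff)

section \<open>The law of the random diagonal sum\<close>

lemma (in prob_space) measurable_diagonal_sum:
  fixes X :: "nat \<Rightarrow> nat \<Rightarrow> 'a \<Rightarrow> nat"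
  assumes "\<And>j r. j \<in> {1..n} \<Longrightarrow> r \<in> {1..n} \<Longrightarrow> X j r \<in> measurable M (count_space UNIV)"
    and "\<pi> \<in> measurable M (count_space (perms n))"
  shows "(\<lambda>\<omega>. \<Sum>j=1..n. X j (\<pi> \<omega> j) \<omega>) \<in> measurable M (count_space UNIV)"
proof (rule measurable_compose_countable'[where g = \<pi> and I = "perms n"])
  fix \<sigma> assume "\<sigma> \<in> perms n"
  then have "\<sigma> j \<in> {1..n}" if "j \<in> {1..n}" for j
    using that permutes_in_image[of \<sigma> "{1..n}" j] by (simp add: perms_def)
  then show "(\<lambda>\<omega>. \<Sum>j=1..n. X j (\<sigma> j) \<omega>) \<in> measurable M (count_space UNIV)"
    by (intro measurable_sum_nat assms(1))
qed (use assms(2) in \<open>auto intro: countable_finite\<close>)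

lemma (in prob_space) prob_diagonal_event:
  fixes X :: "nat \<Rightarrow> nat \<Rightarrow> 'a \<Rightarrow> nat"
  assumes X: "\<And>j r. j \<in> {1..n} \<Longrightarrow> r \<in> {1..n} \<Longrightarrow> X j r \<in> measurable M (count_space UNIV)"
    and law: "\<And>j r. j \<in> {1..n} \<Longrightarrow> r \<in> {1..n} \<Longrightarrow>
      distr M (count_space UNIV) (X j r) = measure_pmf (map_pmf of_bool (bernoulli_pmf (p j r)))"
    and p01: "\<And>j r. j \<in> {1..n} \<Longrightarrow> r \<in> {1..n} \<Longrightarrow> p j r \<in> {0..1}"
    and \<pi>: "\<pi> \<in> measurable M (count_space (perms n))"
    and unif: "distr M (count_space (perms n)) \<pi> = uniform_count_measure (perms n)"
    and indep: "indep_matrix_perm n X \<pi>"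
    and \<sigma>: "\<sigma> \<in> perms n" and A: "A \<subseteq> {1..n}"
  defines "E \<equiv> {\<omega> \<in> space M. \<pi> \<omega> = \<sigma> \<and> (\<forall>j\<in>{1..n}. X j (\<sigma> j) \<omega> = of_bool (j \<in> A))}"
  shows "E \<in> events"
    and "prob E = (\<Prod>j\<in>A. p j (\<sigma> j)) * (\<Prod>j\<in>{1..n} - A. 1 - p j (\<sigma> j)) / fact n"
proof -
  define B where "B = (\<lambda>i. case i of None \<Rightarrow> \<pi> -` {\<sigma>} \<inter> space M
    | Some (j, r) \<Rightarrow> X j r -` {of_bool (j \<in> A)} \<inter> space M)"
  define K where "K = insert None (Some ` (\<lambda>j. (j, \<sigma> j)) ` {1..n})"
  have \<sigma>n: "\<sigma> j \<in> {1..n}" if "j \<in> {1..n}" for j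
    using that \<sigma> permutes_in_image[of \<sigma> "{1..n}" j] by (simp add: perms_def)
  have inj: "inj_on (\<lambda>j. Some (j, \<sigma> j)) {1..n}"
    by (auto simp: inj_on_def)
  have reindex: "(\<Prod>i\<in>(\<lambda>j. Some (j, \<sigma> j)) ` {1..n}. prob (B i)) =
      (\<Prod>j=1..n. prob (B (Some (j, \<sigma> j))))"
    by (simp only: prod.reindex[OF inj] o_def)
  have E: "E = (\<Inter>i\<in>K. B i)"
    by (auto simp: E_def K_def B_def)
  have "B None \<in> events"
    unfolding B_def using measurable_sets[OF \<pi>, of "{\<sigma>}"] \<sigma> by simp
  moreover have "B (Some (j, \<sigma> j)) \<in> events" if "j \<in> {1..n}" for j
    unfolding B_def using measurable_sets[OF X[OF that \<sigma>n[OF that]]] by simp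
  ultimately show "E \<in> events"
    unfolding E by (intro sets.finite_INT) (auto simp: K_def)
  have "prob (\<Inter>i\<in>K. B i) = (\<Prod>i\<in>K. prob (B i))"
  proof (rule indep_setsD[OF indep[unfolded indep_matrix_perm_def]])
    show "\<forall>i\<in>K. B i \<in> (case i of None \<Rightarrow> {\<pi> -` A \<inter> space M | A. A \<in> sets (count_space (perms n))}
        | Some (j, r) \<Rightarrow> {X j r -` A \<inter> space M | A. A \<in> sets (count_space UNIV)})"
      using \<sigma> by (auto simp: K_def B_def)
  qed (use \<sigma>n in \<open>auto simp: K_def\<close>)
  also have "\<dots> = prob (B None) * (\<Prod>j=1..n. prob (B (Some (j, \<sigma> j))))"
    unfolding K_def image_image reindex[symmetric] by (rule prod.insert) auto
  also have "prob (B None) = 1 / fact n"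
  proof -
    have "prob (B None) = measure (distr M (count_space (perms n)) \<pi>) {\<sigma>}"
      unfolding B_def using \<pi> \<sigma> by (simp add: measure_distr)
    then show ?thesis
      unfolding unif using \<sigma> by (simp add: measure_uniform_count_measure card_perms)
  qed
  also have "(\<Prod>j=1..n. prob (B (Some (j, \<sigma> j)))) =
      (\<Prod>j=1..n. if j \<in> A then p j (\<sigma> j) else 1 - p j (\<sigma> j))"
  proof (intro prod.cong refl)
    fix j assume j: "j \<in> {1..n}"
    have p: "0 \<le> p j (\<sigma> j)" "p j (\<sigma> j) \<le> 1" using p01[OF j \<sigma>n[OF j]] by auto
    have "prob (B (Some (j, \<sigma> j))) = measure (distr M (count_space UNIV) (X j (\<sigma> j))) {of_bool (j \<in> A)}"
      unfolding B_def using X[OF j \<sigma>n[OF j]] by (simp add: measure_distr)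
    also have "\<dots> = measure (bernoulli_pmf (p j (\<sigma> j))) {j \<in> A}"
      unfolding law[OF j \<sigma>n[OF j]] measure_map_pmf
      by (rule arg_cong[where f = "measure _"]) (auto simp: of_bool_def split: if_splits)
    also have "\<dots> = (if j \<in> A then p j (\<sigma> j) else 1 - p j (\<sigma> j))"
      using p by (simp add: measure_pmf_single)
    finally show "prob (B (Some (j, \<sigma> j))) = \<dots>" .
  qed
  also have "\<dots> = (\<Prod>j\<in>A. p j (\<sigma> j)) * (\<Prod>j\<in>{1..n} - A. 1 - p j (\<sigma> j))"
    using A by (simp add: prod.If_cases Int_absorb1 Diff_eq)
  finally show "prob E = (\<Prod>j\<in>A. p j (\<sigma> j)) * (\<Prod>j\<in>{1..n} - A. 1 - p j (\<sigma> j)) / fact n"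
    unfolding E by simp
qed

text \<open>
  The law of the random diagonal sum is the mixture, over the permutations, of the laws of sums of
  independent Bernoulli variables.
\<close>

lemma (in prob_space) expectation_diagonal_sum:
  fixes X :: "nat \<Rightarrow> nat \<Rightarrow> 'a \<Rightarrow> nat" and f :: "nat \<Rightarrow> real"
  assumes X: "\<And>j r. j \<in> {1..n} \<Longrightarrow> r \<in> {1..n} \<Longrightarrow> X j r \<in> measurable M (count_space UNIV)"
    and law: "\<And>j r. j \<in> {1..n} \<Longrightarrow> r \<in> {1..n} \<Longrightarrow>
      distr M (count_space UNIV) (X j r) = measure_pmf (map_pmf of_bool (bernoulli_pmf (p j r)))"
    and p01: "\<And>j r. j \<in> {1..n} \<Longrightarrow> r \<in> {1..n} \<Longrightarrow> p j r \<in> {0..1}"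
    and \<pi>: "\<pi> \<in> measurable M (count_space (perms n))"
    and unif: "distr M (count_space (perms n)) \<pi> = uniform_count_measure (perms n)"
    and indep: "indep_matrix_perm n X \<pi>"
  shows "expectation (\<lambda>\<omega>. f (\<Sum>j=1..n. X j (\<pi> \<omega> j) \<omega>)) =
    (\<Sum>\<sigma>\<in>perms n. poisbin {1..n} (\<lambda>j. p j (\<sigma> j)) f) / fact n"
proof -
  define E where "E = (\<lambda>\<sigma> A. {\<omega> \<in> space M. \<pi> \<omega> = \<sigma> \<and>
    (\<forall>j\<in>{1..n}. X j (\<sigma> j) \<omega> = of_bool (j \<in> A))})"
  have event: "E \<sigma> A \<in> events"
    "prob (E \<sigma> A) = (\<Prod>j\<in>A. p j (\<sigma> j)) * (\<Prod>j\<in>{1..n} - A. 1 - p j (\<sigma> j)) / fact n"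
    if "\<sigma> \<in> perms n" "A \<subseteq> {1..n}" for \<sigma> A
    unfolding E_def
    by (rule prob_diagonal_event(1), rule X, assumption+, rule law, assumption+, rule p01, assumption+,
        (rule \<pi> unif indep that)+,
        rule prob_diagonal_event(2), rule X, assumption+, rule law, assumption+, rule p01, assumption+,
        (rule \<pi> unif indep that)+)
  let ?S = "\<lambda>\<omega>. \<Sum>j=1..n. X j (\<pi> \<omega> j) \<omega>"
  let ?I = "\<lambda>\<omega>. \<Sum>\<sigma>\<in>perms n. \<Sum>A\<in>Pow {1..n}. f (card A) * indicator (E \<sigma> A) \<omega> :: real"
  have int: "integrable M (\<lambda>\<omega>. f (card A) * indicator (E \<sigma> A) \<omega>)"
    if "\<sigma> \<in> perms n" "A \<in> Pow {1..n}" for \<sigma> A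
    using event(1)[OF that(1), of A] that(2)
    by (intro integrable_mult_right integrable_real_indicator) (auto simp: less_top[symmetric])
  have AE: "AE \<omega> in M. X j r \<omega> \<in> {0, 1}" if jr: "j \<in> {1..n}" "r \<in> {1..n}" for j r
  proof (rule AE_distrD[OF X[OF jr]])
    show "AE x in distr M (count_space UNIV) (X j r). x \<in> {0, 1}"
      unfolding law[OF jr] AE_measure_pmf_iff by auto
  qed
  have "AE \<omega> in M. \<forall>j\<in>{1..n}. \<forall>r\<in>{1..n}. X j r \<omega> \<in> {0, 1}"
    by (intro AE_finite_allI AE) auto
  then have "AE \<omega> in M. f (?S \<omega>) = ?I \<omega>"
  proof (rule AE_mp, intro AE_I2 impI)
    fix \<omega> assume \<omega>: "\<omega> \<in> space M" and bin: "\<forall>j\<in>{1..n}. \<forall>r\<in>{1..n}. X j r \<omega> \<in> {0, 1}"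
    define \<sigma> where "\<sigma> = \<pi> \<omega>"
    define A where "A = {j \<in> {1..n}. X j (\<sigma> j) \<omega> = 1}"
    have \<sigma>: "\<sigma> \<in> perms n"
      using measurable_space[OF \<pi> \<omega>] by (simp add: \<sigma>_def)
    then have \<sigma>n: "\<sigma> j \<in> {1..n}" if "j \<in> {1..n}" for j
      using that permutes_in_image[of \<sigma> "{1..n}" j] by (simp add: perms_def)
    have bin': "X j (\<sigma> j) \<omega> \<in> {0, 1}" if "j \<in> {1..n}" for j
      using bin \<sigma>n[OF that] that by blast
    have XA: "X j (\<sigma> j) \<omega> = of_bool (j \<in> A)" if "j \<in> {1..n}" for j
      using bin'[OF that] that by (auto simp: A_def)
    have mem: "\<omega> \<in> E \<sigma>' A' \<longleftrightarrow> \<sigma>' = \<sigma> \<and> A' = A" if "A' \<in> Pow {1..n}" for \<sigma>' A'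
    proof
      assume "\<omega> \<in> E \<sigma>' A'"
      then have "\<sigma>' = \<sigma>" and *: "\<forall>j\<in>{1..n}. X j (\<sigma> j) \<omega> = of_bool (j \<in> A')"
        by (auto simp: E_def \<sigma>_def)
      have "j \<in> A' \<longleftrightarrow> j \<in> A" if "j \<in> {1..n}" for j
        using * that by (auto simp: A_def)
      moreover have "A \<subseteq> {1..n}" by (auto simp: A_def)
      ultimately show "\<sigma>' = \<sigma> \<and> A' = A" using \<open>\<sigma>' = \<sigma>\<close> that by blast
    next
      assume "\<sigma>' = \<sigma> \<and> A' = A"
      then show "\<omega> \<in> E \<sigma>' A'" using \<omega> XA by (simp add: E_def \<sigma>_def)
    qed
    have "?S \<omega> = (\<Sum>j=1..n. of_bool (j \<in> A))"
      unfolding \<sigma>_def[symmetric] by (intro sum.cong refl XA)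
    also have "\<dots> = card A"
      by (simp add: A_def Int_def conj_commute)
    finally have S: "?S \<omega> = card A" .
    have "?I \<omega> = (\<Sum>\<sigma>'\<in>perms n. \<Sum>A'\<in>Pow {1..n}. if \<sigma>' = \<sigma> then if A' = A then f (card A) else 0 else 0)"
      using mem by (intro sum.cong refl) (auto simp: indicator_def)
    also have "\<dots> = (\<Sum>\<sigma>'\<in>perms n. if \<sigma>' = \<sigma> then \<Sum>A'\<in>Pow {1..n}. if A' = A then f (card A) else 0 else 0)"
      by (intro sum.cong refl) auto
    also have "\<dots> = f (card A)"
      using \<sigma> by (subst sum.delta) (auto simp: A_def sum.delta')
    finally show "f (?S \<omega>) = ?I \<omega>" unfolding S by simp
  qed
  moreover have "(\<lambda>\<omega>. f (?S \<omega>)) \<in> borel_measurable M"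
    by (rule measurable_compose[OF measurable_diagonal_sum[OF X \<pi>]]) simp_all
  moreover have "?I \<in> borel_measurable M"
    using int by (intro borel_measurable_sum borel_measurable_integrable)
  ultimately have "expectation (\<lambda>\<omega>. f (?S \<omega>)) = expectation ?I"
    by (intro integral_cong_AE)
  also have "\<dots> = (\<Sum>\<sigma>\<in>perms n. expectation (\<lambda>\<omega>. \<Sum>A\<in>Pow {1..n}. f (card A) * indicator (E \<sigma> A) \<omega>))"
    by (rule Bochner_Integration.integral_sum) (intro Bochner_Integration.integrable_sum int)
  also have "\<dots> = (\<Sum>\<sigma>\<in>perms n. \<Sum>A\<in>Pow {1..n}. expectation (\<lambda>\<omega>. f (card A) * indicator (E \<sigma> A) \<omega>))"
    by (intro sum.cong[OF refl] Bochner_Integration.integral_sum int)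
  also have "\<dots> = (\<Sum>\<sigma>\<in>perms n. \<Sum>A\<in>Pow {1..n}. f (card A) * prob (E \<sigma> A))"
    by (intro sum.cong refl) (simp add: event(1))
  also have "\<dots> = (\<Sum>\<sigma>\<in>perms n. poisbin {1..n} (\<lambda>j. p j (\<sigma> j)) f) / fact n"
    unfolding poisbin_def sum_divide_distrib
    by (intro sum.cong refl) (simp add: event(2) mult_ac)
  finally show ?thesis .
qed

section \<open>The Stein bound and the variance\<close>

lemma stein_local_one:
  "stein_local p \<sigma> j k 1 1 = 2 * (p j (\<sigma> k) * p j (\<sigma> j) + p k (\<sigma> k) * p k (\<sigma> j)) +
    2 * ((p j (\<sigma> k) - p j (\<sigma> j)) * (p k (\<sigma> k) - p k (\<sigma> j)))"
  by (simp add: stein_local_def Let_def)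

text \<open>
  The cubic part \<open>t\<close> moves weight from \<open>x\<close> to \<open>y\<close>. It disappears from the bound because
  \<open>0 \<le> t \<le> 2 * (a * b + c * d)\<close>, so that both weights stay nonnegative.
\<close>

lemma abs_stein_local_le:
  assumes p01: "\<And>i r. i \<in> {j, k} \<Longrightarrow> r \<in> {\<sigma> j, \<sigma> k} \<Longrightarrow> p i r \<in> {0..1}"
    and x: "\<bar>x\<bar> \<le> C" and y: "\<bar>y\<bar> \<le> C"
  shows "\<bar>stein_local p \<sigma> j k x y\<bar> \<le> C * (2 * (p j (\<sigma> k) * p j (\<sigma> j) + p k (\<sigma> k) * p k (\<sigma> j)) +
    2 * \<bar>(p j (\<sigma> k) - p j (\<sigma> j)) * (p k (\<sigma> k) - p k (\<sigma> j))\<bar>)"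
proof -
  define a b c d where "a = p j (\<sigma> k)" and "b = p j (\<sigma> j)" and "c = p k (\<sigma> k)" and "d = p k (\<sigma> j)"
  note abcd = a_def b_def c_def d_def
  define t where "t = a * b * (c + d) + c * d * (a + b)"
  define e where "e = (a - b) * (c - d)"
  have 0: "0 \<le> a" "0 \<le> b" "0 \<le> c" "0 \<le> d" and 1: "a \<le> 1" "b \<le> 1" "c \<le> 1" "d \<le> 1"
    using p01 by (auto simp: abcd)
  have t0: "0 \<le> t" using 0 by (simp add: t_def)
  have "a * b * (c + d) \<le> a * b * 2" "c * d * (a + b) \<le> c * d * 2"
    using 0 1 by (auto intro!: mult_left_mono)
  then have t: "0 \<le> 2 * (a * b + c * d) - t" by (simp add: t_def)
  have "\<bar>(2 * (a * b + c * d) - t) * x + 2 * e * x + t * y\<bar> \<le>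
      (2 * (a * b + c * d) - t) * \<bar>x\<bar> + 2 * \<bar>e\<bar> * \<bar>x\<bar> + t * \<bar>y\<bar>"
    using t t0 by (intro order.trans[OF abs_triangle_ineq] add_mono) (auto simp: abs_mult)
  also have "\<dots> \<le> (2 * (a * b + c * d) - t) * C + 2 * \<bar>e\<bar> * C + t * C"
    using t t0 x y by (intro add_mono mult_left_mono) auto
  finally show ?thesis
    unfolding stein_local_def Let_def abcd[symmetric] t_def[symmetric] e_def[symmetric]
    by (simp add: algebra_simps)
qed

text \<open>
  The expectation of \<open>f\<close> at the random diagonal sum, as an average over the permutations.
\<close>

definition perm_avg :: "nat \<Rightarrow> (nat \<Rightarrow> nat \<Rightarrow> real) \<Rightarrow> (nat \<Rightarrow> real) \<Rightarrow> real" where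
  "perm_avg n p f = (\<Sum>\<sigma>\<in>perms n. poisbin {1..n} (\<lambda>j. p j (\<sigma> j)) f) / fact n"

lemma perm_avg_const: "perm_avg n p (\<lambda>_. c) = c"
  by (simp add: perm_avg_def poisbin_const card_perms)

lemma perm_avg_add: "perm_avg n p (\<lambda>k. f k + g k) = perm_avg n p f + perm_avg n p g"
  by (simp add: perm_avg_def poisbin_add sum.distrib add_divide_distrib)

lemma perm_avg_cmult: "perm_avg n p (\<lambda>k. c * f k) = c * perm_avg n p f"
  by (simp add: perm_avg_def poisbin_cmult sum_distrib_left)

lemma perm_avg_mean:
  assumes n: "n \<ge> 2"
  shows "real n * perm_avg n p real = (\<Sum>j=1..n. \<Sum>r=1..n. p j r)"
proof -
  have "poisbin {1..n} q real = (\<Sum>j=1..n. q j)" for q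
    using poisbin_size_bias[of "{1..n}" q "\<lambda>_. 1"] by (simp add: poisbin_const)
  then have "perm_avg n p real = (\<Sum>j=1..n. \<Sum>\<sigma>\<in>perms n. p j (\<sigma> j)) / fact n"
    unfolding perm_avg_def by (simp only: sum.swap[of _ "perms n"])
  then have "real n * perm_avg n p real = (\<Sum>j=1..n. real n * (\<Sum>\<sigma>\<in>perms n. p j (\<sigma> j))) / fact n"
    by (simp add: sum_distrib_left)
  also have "(\<Sum>j=1..n. real n * (\<Sum>\<sigma>\<in>perms n. p j (\<sigma> j))) = (\<Sum>j=1..n. fact n * (\<Sum>r=1..n. p j r))"
    by (intro sum.cong refl sum_perms_single[OF n])
  finally show ?thesis by (simp flip: sum_distrib_left)
qed

lemma perm_avg_stein:
  fixes p :: "nat \<Rightarrow> nat \<Rightarrow> real" and g :: "nat \<Rightarrow> real" and n :: nat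
  assumes n: "n \<ge> 2" and lam: "lam = perm_avg n p real"
  defines "\<Delta> \<equiv> \<lambda>m. g (Suc (Suc m)) - g (Suc m)"
  defines "Q \<equiv> \<lambda>\<sigma> J. poisbin ({1..n} - J) (\<lambda>i. p i (\<sigma> i))"
  shows "perm_avg n p (\<lambda>k. lam * g (Suc k) - real k * g k) =
    ((\<Sum>j=1..n. \<Sum>\<sigma>\<in>perms n. (p j (\<sigma> j))\<^sup>2 * Q \<sigma> {j} \<Delta>) +
    1 / 4 * (\<Sum>(j, k)\<in>distinct_pairs n. \<Sum>\<sigma>\<in>perms n.
       stein_local p \<sigma> j k (Q \<sigma> {j, k} \<Delta>) (Q \<sigma> {j, k} (\<lambda>m. \<Delta> (Suc m))))) / (real n * fact n)"
    (is "_ = ?rhs / _")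
proof -
  have nlam: "(\<Sum>j=1..n. \<Sum>r=1..n. p j r) = real n * lam"
    unfolding lam perm_avg_mean[OF n] ..
  have "?rhs = (\<Sum>\<sigma>\<in>perms n. real n * lam * Q \<sigma> {} (\<lambda>k. g (Suc k)) -
      real n * Q \<sigma> {} (\<lambda>k. real k * g k))"
    using stein_identity[of p n g] unfolding nlam \<Delta>_def Q_def by simp
  also have "\<dots> = real n * (\<Sum>\<sigma>\<in>perms n. Q \<sigma> {} (\<lambda>k. lam * g (Suc k) - real k * g k))"
    unfolding Q_def poisbin_diff poisbin_cmult by (simp add: sum_distrib_left right_diff_distrib mult.assoc)
  finally show ?thesis
    using n by (simp add: perm_avg_def Q_def)
qed

lemma abs_perm_avg_stein_le:
  fixes p :: "nat \<Rightarrow> nat \<Rightarrow> real" and g :: "nat \<Rightarrow> real" and n :: nat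
  assumes n: "n \<ge> 2" and lam: "lam = perm_avg n p real"
    and p01: "\<And>j r. j \<in> {1..n} \<Longrightarrow> r \<in> {1..n} \<Longrightarrow> p j r \<in> {0..1}"
    and g: "\<And>k. k > 0 \<Longrightarrow> \<bar>g (Suc k) - g k\<bar> \<le> C"
  shows "\<bar>perm_avg n p (\<lambda>k. lam * g (Suc k) - real k * g k)\<bar> \<le>
    C * ((\<Sum>j=1..n. (row_mean n p j)\<^sup>2) + gamma2 n p)"
proof -
  define \<Delta> where "\<Delta> = (\<lambda>m. g (Suc (Suc m)) - g (Suc m))"
  define Q where "Q = (\<lambda>\<sigma> J. poisbin ({1..n} - J) (\<lambda>i. p i (\<sigma> i)))"
  define T where "T = (\<lambda>\<sigma> j k. 2 * (p j (\<sigma> k) * p j (\<sigma> j) + p k (\<sigma> k) * p k (\<sigma> j)) +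
      2 * \<bar>(p j (\<sigma> k) - p j (\<sigma> j)) * (p k (\<sigma> k) - p k (\<sigma> j))\<bar>)"
  have \<sigma>n: "\<sigma> j \<in> {1..n}" if "\<sigma> \<in> perms n" "j \<in> {1..n}" for \<sigma> j
    using that permutes_in_image[of \<sigma> "{1..n}" j] by (simp add: perms_def)
  have \<Delta>: "\<bar>\<Delta> m\<bar> \<le> C" for m
    using g[of "Suc m"] by (simp add: \<Delta>_def)
  have Q: "\<bar>Q \<sigma> J f\<bar> \<le> C" if "\<sigma> \<in> perms n" "\<And>m. \<bar>f m\<bar> \<le> C" for \<sigma> J f
    unfolding Q_def using p01[OF _ \<sigma>n[OF that(1)]] that(2) by (intro abs_poisbin_le) auto
  have 1: "\<bar>\<Sum>j=1..n. \<Sum>\<sigma>\<in>perms n. (p j (\<sigma> j))\<^sup>2 * Q \<sigma> {j} \<Delta>\<bar> \<le>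
      (\<Sum>j=1..n. \<Sum>\<sigma>\<in>perms n. C * (p j (\<sigma> j))\<^sup>2)"
  proof (intro order.trans[OF sum_abs] sum_mono)
    fix j \<sigma> assume "\<sigma> \<in> perms n"
    then show "\<bar>(p j (\<sigma> j))\<^sup>2 * Q \<sigma> {j} \<Delta>\<bar> \<le> C * (p j (\<sigma> j))\<^sup>2"
      using Q[OF _ \<Delta>] by (simp add: abs_mult mult.commute mult_right_mono)
  qed
  have 2: "\<bar>\<Sum>(j, k)\<in>distinct_pairs n. \<Sum>\<sigma>\<in>perms n.
       stein_local p \<sigma> j k (Q \<sigma> {j, k} \<Delta>) (Q \<sigma> {j, k} (\<lambda>m. \<Delta> (Suc m)))\<bar> \<le>
      (\<Sum>(j, k)\<in>distinct_pairs n. \<Sum>\<sigma>\<in>perms n. C * T \<sigma> j k)"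
    unfolding case_prod_unfold
  proof (intro order.trans[OF sum_abs] sum_mono)
    fix x \<sigma> assume x: "x \<in> distinct_pairs n" and \<sigma>: "\<sigma> \<in> perms n"
    then have jk: "fst x \<in> {1..n}" "snd x \<in> {1..n}" by (auto simp: distinct_pairs_def)
    show "\<bar>stein_local p \<sigma> (fst x) (snd x) (Q \<sigma> {fst x, snd x} \<Delta>)
        (Q \<sigma> {fst x, snd x} (\<lambda>m. \<Delta> (Suc m)))\<bar> \<le> C * T \<sigma> (fst x) (snd x)"
      unfolding T_def using jk \<sigma>n[OF \<sigma> jk(1)] \<sigma>n[OF \<sigma> jk(2)]
      by (intro abs_stein_local_le Q[OF \<sigma>] \<Delta> p01) auto
  qed
  have "\<bar>perm_avg n p (\<lambda>k. lam * g (Suc k) - real k * g k)\<bar> =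
    \<bar>(\<Sum>j=1..n. \<Sum>\<sigma>\<in>perms n. (p j (\<sigma> j))\<^sup>2 * Q \<sigma> {j} \<Delta>) +
    1 / 4 * (\<Sum>(j, k)\<in>distinct_pairs n. \<Sum>\<sigma>\<in>perms n.
       stein_local p \<sigma> j k (Q \<sigma> {j, k} \<Delta>) (Q \<sigma> {j, k} (\<lambda>m. \<Delta> (Suc m))))\<bar> / (real n * fact n)"
    unfolding perm_avg_stein[OF n lam] \<Delta>_def Q_def by (simp add: abs_mult)
  also have "\<dots> \<le> ((\<Sum>j=1..n. \<Sum>\<sigma>\<in>perms n. C * (p j (\<sigma> j))\<^sup>2) +
      1 / 4 * (\<Sum>(j, k)\<in>distinct_pairs n. \<Sum>\<sigma>\<in>perms n. C * T \<sigma> j k)) / (real n * fact n)"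
    using 1 2 by (intro divide_right_mono) auto
  also have "\<dots> = C * (((\<Sum>j=1..n. \<Sum>\<sigma>\<in>perms n. (p j (\<sigma> j))\<^sup>2) +
      1 / 4 * (\<Sum>(j, k)\<in>distinct_pairs n. \<Sum>\<sigma>\<in>perms n. T \<sigma> j k)) / (real n * fact n))"
    by (simp add: distrib_left sum_distrib_left case_prod_unfold mult.assoc mult.left_commute)
  also have "((\<Sum>j=1..n. \<Sum>\<sigma>\<in>perms n. (p j (\<sigma> j))\<^sup>2) +
      1 / 4 * (\<Sum>(j, k)\<in>distinct_pairs n. \<Sum>\<sigma>\<in>perms n. T \<sigma> j k)) / (real n * fact n) =
      (\<Sum>j=1..n. (row_mean n p j)\<^sup>2) + gamma2 n p"
    using perm_average_reduction[OF n, of p abs] by (simp only: T_def gamma2_def abs_mult)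
  finally show ?thesis .
qed

text \<open>
  The Stein identity for \<open>g k = k\<close>, where all increments equal 1.
\<close>

lemma perm_avg_variance:
  fixes p :: "nat \<Rightarrow> nat \<Rightarrow> real" and n :: nat
  assumes n: "n \<ge> 2" and lam: "lam = perm_avg n p real"
  shows "lam - perm_avg n p (\<lambda>k. (real k - lam)\<^sup>2) =
    (\<Sum>j=1..n. (row_mean n p j)\<^sup>2) + gamma2 n p - gamma1 n p"
proof -
  have "lam - perm_avg n p (\<lambda>k. (real k - lam)\<^sup>2) = perm_avg n p (\<lambda>k. lam * real (Suc k) - real k * real k)"
  proof -
    have "(\<lambda>k. (real k - lam)\<^sup>2) =
        (\<lambda>k. (- 1) * (lam * real (Suc k) - real k * real k) + ((- lam) * real k + (lam + lam\<^sup>2)))"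
      by (auto simp: fun_eq_iff power2_eq_square algebra_simps)
    then have "perm_avg n p (\<lambda>k. (real k - lam)\<^sup>2) =
        - perm_avg n p (\<lambda>k. lam * real (Suc k) - real k * real k) + (- lam * lam + (lam + lam\<^sup>2))"
      by (simp only: perm_avg_add perm_avg_cmult perm_avg_const flip: lam)
    then show ?thesis by (simp add: power2_eq_square)
  qed
  also have "\<dots> = ((\<Sum>j=1..n. \<Sum>\<sigma>\<in>perms n. (p j (\<sigma> j))\<^sup>2) +
      1 / 4 * (\<Sum>(j, k)\<in>distinct_pairs n. \<Sum>\<sigma>\<in>perms n. stein_local p \<sigma> j k 1 1)) / (real n * fact n)"
    unfolding perm_avg_stein[OF n lam, of real] by (simp add: poisbin_const)
  also have "\<dots> = (\<Sum>j=1..n. (row_mean n p j)\<^sup>2) + gamma2 n p - gamma1 n p"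
    unfolding stein_local_one perm_average_reduction[OF n, where \<psi> = "\<lambda>x. x"] gamma1_eq by simp
  finally show ?thesis .
qed

section \<open>The Poisson approximation\<close>

theorem theorem2p1:
  fixes M :: "'w measure" and n :: nat
    and p :: "nat \<Rightarrow> nat \<Rightarrow> real"
    and X :: "nat \<Rightarrow> nat \<Rightarrow> 'w \<Rightarrow> nat"
    and \<pi> :: "'w \<Rightarrow> nat \<Rightarrow> nat"
    and S :: "'w \<Rightarrow> nat"
    and lam :: real
  assumes "prob_space M"
    and "n \<ge> 2"
    and "\<And>j r. j \<in> {1..n} \<Longrightarrow> r \<in> {1..n} \<Longrightarrow> p j r \<in> {0..1}"
    and "\<And>j r. j \<in> {1..n} \<Longrightarrow> r \<in> {1..n} \<Longrightarrow> X j r \<in> measurable M (count_space UNIV)"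
    and "\<And>j r. j \<in> {1..n} \<Longrightarrow> r \<in> {1..n} \<Longrightarrow>
           distr M (count_space UNIV) (X j r) =
             measure_pmf (map_pmf of_bool (bernoulli_pmf (p j r)))"
    and "\<pi> \<in> measurable M (count_space (perms n))"
    and "distr M (count_space (perms n)) \<pi> = uniform_count_measure (perms n)"
    and "prob_space.indep_matrix_perm M n X \<pi>"
    and "S = (\<lambda>\<omega>. \<Sum>j=1..n. X j (\<pi> \<omega> j) \<omega>)"
    and "lam = prob_space.expectation M (\<lambda>\<omega>. real (S \<omega>))"
    and "lam > 0"
  shows "d_TV (distr M (count_space UNIV) S) (measure_pmf (poisson_pmf lam))
           \<le> (1 - exp (- lam)) / lam *
               (lam - prob_space.variance M (\<lambda>\<omega>. real (S \<omega>)) + gamma1 n p)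
       \<and> (1 - exp (- lam)) / lam *
             (lam - prob_space.variance M (\<lambda>\<omega>. real (S \<omega>)) + gamma1 n p)
           = (1 - exp (- lam)) / lam * ((\<Sum>j=1..n. (row_mean n p j)\<^sup>2) + gamma2 n p)
       \<and> (1 - exp (- lam)) / lam * ((\<Sum>j=1..n. (row_mean n p j)\<^sup>2) + gamma2 n p)
           = (1 - exp (- lam)) / lam *
               ((1 / real n) * (\<Sum>j=1..n. \<Sum>r=1..n. (p j r)\<^sup>2) - gamma3 n p)"
proof -
  interpret prob_space M by fact
  note n = \<open>n \<ge> 2\<close> and S_eq = \<open>S = _\<close>
  have S: "S \<in> measurable M (count_space UNIV)"
    unfolding S_eq using assms(4,6) by (rule measurable_diagonal_sum)
  have law: "expectation (\<lambda>\<omega>. f (S \<omega>)) = perm_avg n p f" for f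
    unfolding S_eq perm_avg_def using assms(4,5,3,6-8) by (rule expectation_diagonal_sum)
  have lam: "lam = perm_avg n p real"
    using \<open>lam = _\<close> law by simp
  have var: "variance (\<lambda>\<omega>. real (S \<omega>)) = perm_avg n p (\<lambda>k. (real k - lam)\<^sup>2)"
    using law[of "\<lambda>k. (real k - lam)\<^sup>2"] by (simp flip: \<open>lam = expectation _\<close>)
  have eq: "lam - variance (\<lambda>\<omega>. real (S \<omega>)) + gamma1 n p =
      (\<Sum>j=1..n. (row_mean n p j)\<^sup>2) + gamma2 n p"
    unfolding var using perm_avg_variance[OF n lam] by simp
  have "d_TV (distr M (count_space UNIV) S) (measure_pmf (poisson_pmf lam)) \<le>
      (1 - exp (- lam)) / lam * ((\<Sum>j=1..n. (row_mean n p j)\<^sup>2) + gamma2 n p)"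
    unfolding d_TV_def
  proof (rule cSUP_least)
    fix A :: "nat set"
    have "measure (distr M (count_space UNIV) S) A = expectation (\<lambda>\<omega>. indicator A (S \<omega>))"
      using S by (simp add: measure_distr indicator_vimage[symmetric] indicator_inter_arith
          vimage_def Int_def)
    then have "measure (distr M (count_space UNIV) S) A - measure (poisson_pmf lam) A =
        perm_avg n p (\<lambda>k. indicator A k + (- measure (poisson_pmf lam) A))"
      unfolding law perm_avg_add perm_avg_const by simp
    also have "\<dots> = perm_avg n p (\<lambda>k. lam * stein_sol lam A (Suc k) - real k * stein_sol lam A k)"
      by (simp add: stein_sol_eq[OF \<open>lam > 0\<close>])
    also have "\<bar>\<dots>\<bar> \<le> (1 - exp (- lam)) / lam * ((\<Sum>j=1..n. (row_mean n p j)\<^sup>2) + gamma2 n p)"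
      using assms(3) abs_stein_sol_increment_le[OF \<open>lam > 0\<close>]
      by (intro abs_perm_avg_stein_le n lam)
    finally show "\<bar>measure (distr M (count_space UNIV) S) A - measure (poisson_pmf lam) A\<bar> \<le>
        (1 - exp (- lam)) / lam * ((\<Sum>j=1..n. (row_mean n p j)\<^sup>2) + gamma2 n p)" .
  qed simp
  then show ?thesis
    unfolding eq gamma3_eq[OF n] by simp
qed

end
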